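(* Let $m\ge 2$ and let $f(\mathbf x,\mathbf y)=\sum_{i,j=1}^m\sum_{k,l=1}^2 a_{ijkl}x_ix_jy_ky_l$ be an $m\times 2$ real biquadratic form which is positive definite, i.e. $f(\mathbf x,\mathbf y)>0$ for all $\mathbf x\in\mathbb R^m\setminus\{0\}$, $\mathbf y\in\mathbb R^2\setminus\{0\}$. Then there exists an $(m-1)\times 1\times 1$ degenerated tripartite quartic form $h$ such that $h$ is sos and $\mathrm{sosrank}(f)\le \mathrm{sosrank}(h)+1$.
   Context: All forms have real coefficients and real variables. A form is psd if it takes only nonnegative values on the whole real space. A quartic form is sos if it is a finite sum of squares of real quadratic forms; for an sos form, its sos rank $\mathrm{sosrank}$ is the minimum number of squares in such an expression (an $m\times 2$ positive definite biquadratic form is known to be sos). A $p\times q\times 1$ tripartite quartic form is a homogeneous quartic polynomial $h(\mathbf x,\mathbf y,z)$ in variables $\mathbf x=(x_1,\dots,x_p)$, $\mathbf y=(y_1,\dots,y_q)$ and a single variable $z$ such that in every monomial the total degree in the $\mathbf x$-variables is at most $2$ and the total degree in the $\mathbf y$-variables is at most $2$. It is called degenerated if it is psd and its coefficient of $z^4$ is zero. *)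

theory Defs
  imports Complex_Main "HOL-Library.Poly_Mapping" "HOL-Library.Extended_Nat"
begin

text \<open>
  Forms are formal polynomials with real coefficients: finitely supported maps from monomials
  (finitely supported exponent vectors) to coefficients. The ring operations are the
  convolution operations of \<^theory>\<open>HOL-Library.Poly_Mapping\<close>.
\<close>

datatype var = VX nat | VY nat | VZ

type_synonym monom = "var \<Rightarrow>\<^sub>0 nat"
type_synonym form = "monom \<Rightarrow>\<^sub>0 real"

definition Const :: "real \<Rightarrow> form"
  where "Const c = Poly_Mapping.single 0 c"

definition Var :: "var \<Rightarrow> form"
  where "Var u = Poly_Mapping.single (Poly_Mapping.single u 1) 1"

definition eval :: "(var \<Rightarrow> real) \<Rightarrow> form \<Rightarrow> real"
  where "eval v p =
    (\<Sum>t\<in>Poly_Mapping.keys p.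
       Poly_Mapping.lookup p t * (\<Prod>u\<in>Poly_Mapping.keys t. v u ^ Poly_Mapping.lookup t u))"

definition deg_in :: "var set \<Rightarrow> monom \<Rightarrow> nat"
  where "deg_in S t = (\<Sum>u\<in>Poly_Mapping.keys t \<inter> S. Poly_Mapping.lookup t u)"

definition vars :: "form \<Rightarrow> var set"
  where "vars p = (\<Union>t\<in>Poly_Mapping.keys p. Poly_Mapping.keys t)"

text \<open>As usual, the zero polynomial counts as a form of every degree.\<close>

definition homogeneous :: "nat \<Rightarrow> form \<Rightarrow> bool"
  where "homogeneous d p \<longleftrightarrow> (\<forall>t\<in>Poly_Mapping.keys p. deg_in UNIV t = d)"

definition psd :: "form \<Rightarrow> bool"
  where "psd p \<longleftrightarrow> (\<forall>v. eval v p \<ge> 0)"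

text \<open>
  The quadratic forms in a decomposition are not restricted to the variables of \<open>p\<close>. This makes no
  difference: squares of real forms cannot cancel, so no other variable can occur in them.
  The empty sum is allowed, so the zero form is a sum of 0 squares.
\<close>

definition sum_of_squares :: "nat \<Rightarrow> form \<Rightarrow> bool"
  where "sum_of_squares r p \<longleftrightarrow>
    (\<exists>q :: nat \<Rightarrow> form. (\<forall>i<r. homogeneous 2 (q i)) \<and> p = (\<Sum>i<r. (q i)\<^sup>2))"

definition sos :: "form \<Rightarrow> bool"
  where "sos p \<longleftrightarrow> (\<exists>r. sum_of_squares r p)"

text \<open>For a form that is not sos the infimum is over the empty set and the value is \<open>\<infinity>\<close>.\<close>

definition sosrank :: "form \<Rightarrow> enat"
  where "sosrank p = (INF r\<in>{r. sum_of_squares r p}. enat r)"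

lemma sosrank_eq_Least:
  assumes "sos p"
  shows "sosrank p = enat (LEAST r. sum_of_squares r p)"
proof -
  have "sum_of_squares (LEAST r. sum_of_squares r p) p"
    using assms unfolding sos_def by (rule LeastI_ex)
  then show ?thesis
    unfolding sosrank_def by (intro antisym INF_lower INF_greatest) (auto intro: Least_le)
qed

lemma sosrank_eq_infinity: "\<not> sos p \<Longrightarrow> sosrank p = \<infinity>"
  by (auto simp: sosrank_def sos_def top_enat_def)

definition biquadratic :: "nat \<Rightarrow> nat \<Rightarrow> (nat \<Rightarrow> nat \<Rightarrow> nat \<Rightarrow> nat \<Rightarrow> real) \<Rightarrow> form"
  where "biquadratic m n a =
    (\<Sum>i\<in>{1..m}. \<Sum>j\<in>{1..m}. \<Sum>k\<in>{1..n}. \<Sum>l\<in>{1..n}.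
       Const (a i j k l) * Var (VX i) * Var (VX j) * Var (VY k) * Var (VY l))"

definition biquadratic_pos_def :: "nat \<Rightarrow> nat \<Rightarrow> form \<Rightarrow> bool"
  where "biquadratic_pos_def m n f \<longleftrightarrow>
    (\<forall>v. (\<exists>i\<in>{1..m}. v (VX i) \<noteq> 0) \<longrightarrow> (\<exists>k\<in>{1..n}. v (VY k) \<noteq> 0) \<longrightarrow> eval v f > 0)"

text \<open>A \<open>p \<times> q \<times> 1\<close> tripartite quartic form, with single third variable \<^const>\<open>VZ\<close>.\<close>

definition tripartite_quartic :: "nat \<Rightarrow> nat \<Rightarrow> form \<Rightarrow> bool"
  where "tripartite_quartic p q h \<longleftrightarrow>
    homogeneous 4 h \<and>
    vars h \<subseteq> VX ` {1..p} \<union> VY ` {1..q} \<union> {VZ} \<and>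
    (\<forall>t\<in>Poly_Mapping.keys h. deg_in (range VX) t \<le> 2 \<and> deg_in (range VY) t \<le> 2)"

definition degenerated :: "form \<Rightarrow> bool"
  where "degenerated h \<longleftrightarrow> psd h \<and> Poly_Mapping.lookup h (Poly_Mapping.single VZ 4) = 0"

end

theory Submission
  imports Defs "HOL-Analysis.Function_Topology"
begin

text \<open>
  Subtracting from \<open>f\<close> the largest multiple of the square of a bilinear form that keeps the
  difference \<open>f'\<close> psd produces a nontrivial zero \<open>(x\<^sub>0, y\<^sub>0)\<close> of \<open>f'\<close>. In coordinates
  where this zero is a pair of basis vectors, with \<open>w\<close> the coordinate along \<open>x\<^sub>0\<close> and \<open>z\<close> the one
  along \<open>y\<^sub>0\<close>, the form \<open>h(x, y, z)\<close> is \<open>f'\<close> with \<open>w\<close> set equal to \<open>z\<close>. As \<open>h\<close> vanishes at the basis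
  vectors of \<open>y\<close> and \<open>z\<close> and for \<open>y = z = 0\<close>, the forms in a representation of \<open>h\<close> as a sum of squares
  are combinations of the monomials \<open>x\<^sub>i y\<close>, \<open>x\<^sub>i z\<close> and \<open>y z\<close> only; replacing \<open>y z\<close> by \<open>y w\<close> gives a
  representation of \<open>f'\<close> of the same length, by bihomogeneity. That \<open>f'\<close> is sos at all follows by
  induction on \<open>m\<close>: at a zero, completing the square eliminates the variable \<open>w\<close>, and a form
  without zeros acquires one by subtracting a square.
\<close>

section \<open>Forms and their evaluations\<close>

definition monom_eval :: "(var \<Rightarrow> real) \<Rightarrow> monom \<Rightarrow> real"
  where "monom_eval v t = (\<Prod>u\<in>Poly_Mapping.keys t. v u ^ Poly_Mapping.lookup t u)"

lemma monom_eval_superset: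
  assumes "finite A" "Poly_Mapping.keys t \<subseteq> A"
  shows "monom_eval v t = (\<Prod>u\<in>A. v u ^ Poly_Mapping.lookup t u)"
  unfolding monom_eval_def
  by (rule prod.mono_neutral_left) (use assms in \<open>auto simp: in_keys_iff\<close>)

lemma monom_eval_add: "monom_eval v (s + t) = monom_eval v s * monom_eval v t"
proof -
  let ?A = "Poly_Mapping.keys s \<union> Poly_Mapping.keys t"
  have "Poly_Mapping.keys (s + t) \<subseteq> ?A"
    by (rule Poly_Mapping.keys_add)
  then show ?thesis
    by (simp add: monom_eval_superset[of ?A] lookup_add power_add prod.distrib)
qed

lemma monom_eval_mult: "monom_eval (\<lambda>u. v u * w u) t = monom_eval v t * monom_eval w t"
  by (simp add: monom_eval_def power_mult_distrib prod.distrib)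

text \<open>An assignment that is 1 except at one variable reads off the exponent of that variable;
  with the value 2 there it separates monomials whose exponents differ.\<close>

lemma monom_eval_fun_upd:
  "monom_eval ((\<lambda>_. 1)(u := c)) t = c ^ Poly_Mapping.lookup t u"
proof -
  have "monom_eval ((\<lambda>_. 1)(u := c)) t =
      (\<Prod>u'\<in>insert u (Poly_Mapping.keys t). ((\<lambda>_. 1)(u := c)) u' ^ Poly_Mapping.lookup t u')"
    by (rule monom_eval_superset) auto
  also have "\<dots> = (\<Prod>u'\<in>insert u (Poly_Mapping.keys t).
      if u' = u then c ^ Poly_Mapping.lookup t u else 1)"
    by (rule prod.cong) auto
  finally show ?thesis
    by simp
qed

lemma monom_eval_single [simp]: "monom_eval v (Poly_Mapping.single u n) = v u ^ n"
  by (simp add: monom_eval_def)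

lemma monom_eval_zero [simp]: "monom_eval v 0 = 1"
  by (simp add: monom_eval_def)

text \<open>Dedekind's argument for the linear independence of characters, the characters being the
  evaluations of monomials on the multiplicative monoid of assignments.\<close>

lemma monom_eval_linear_independent:
  assumes "finite A" "\<And>v. (\<Sum>t\<in>A. c t * monom_eval v t) = 0" "t \<in> A"
  shows "c t = 0"
  using assms
proof (induction A arbitrary: c t rule: finite_induct)
  case (insert s A)
  have below: "c r = 0" if r: "r \<in> A" for r
  proof -
    have "r \<noteq> s"
      using insert.hyps r by auto
    then obtain u where u: "Poly_Mapping.lookup r u \<noteq> Poly_Mapping.lookup s u"
      by (meson poly_mapping_eqI)
    \<comment> \<open>Rescaling coordinate \<open>u\<close> by 2 and subtracting a multiple of the
      original relation cancels the term at \<open>s\<close>; the term at \<open>r\<close> gets a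
      nonzero factor, as distinct powers of 2 differ.\<close>
    let ?d = "\<lambda>t. c t * (2 ^ Poly_Mapping.lookup t u - 2 ^ Poly_Mapping.lookup s u)"
    have "(\<Sum>t\<in>A. ?d t * monom_eval v t) = 0" for v
    proof -
      let ?v = "\<lambda>w. v w * ((\<lambda>_. 1)(u := 2)) w"
      have "(\<Sum>t\<in>insert s A. c t * monom_eval ?v t)
          - 2 ^ Poly_Mapping.lookup s u * (\<Sum>t\<in>insert s A. c t * monom_eval v t) = 0"
        unfolding insert.prems(1) by simp
      then have "(\<Sum>t\<in>insert s A. ?d t * monom_eval v t) = 0"
        unfolding monom_eval_mult monom_eval_fun_upd
        by (simp only: sum_distrib_left sum_subtractf[symmetric]) (simp only: algebra_simps)
      then show ?thesis
        using insert.hyps by simp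
    qed
    then have "?d r = 0"
      using insert.IH[of ?d r] r by blast
    then show ?thesis
      using u by simp
  qed
  have "c s = 0"
    using insert.prems(1)[of "\<lambda>_. 1"] insert.hyps below by (simp add: monom_eval_def)
  then show ?case
    using below insert.prems(2) by auto
qed simp

section \<open>Evaluation as an injective ring homomorphism on forms\<close>

lemma eval_superset:
  assumes "finite A" "Poly_Mapping.keys p \<subseteq> A"
  shows "eval v p = (\<Sum>t\<in>A. Poly_Mapping.lookup p t * monom_eval v t)"
  unfolding eval_def monom_eval_def
  by (rule sum.mono_neutral_left) (use assms in \<open>auto simp: in_keys_iff\<close>)

lemma eval_eq: "eval v p = (\<Sum>t\<in>Poly_Mapping.keys p. Poly_Mapping.lookup p t * monom_eval v t)"
  by (rule eval_superset) auto

lemma eval_zero [simp]: "eval v 0 = 0"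
  by (simp add: eval_def)

lemma eval_single: "eval v (Poly_Mapping.single t c) = c * monom_eval v t"
  by (subst eval_superset[of "{t}"]) (auto split: if_splits)

lemma eval_add [simp]: "eval v (p + q) = eval v p + eval v q"
proof -
  let ?A = "Poly_Mapping.keys p \<union> Poly_Mapping.keys q"
  have "Poly_Mapping.keys (p + q) \<subseteq> ?A"
    by (rule Poly_Mapping.keys_add)
  then show ?thesis
    by (simp add: eval_superset[of ?A] lookup_add sum.distrib algebra_simps)
qed

lemma eval_diff [simp]: "eval v (p - q) = eval v p - eval v q"
  using eval_add[of v "p - q" q] by simp

lemma eval_sum [simp]: "eval v (\<Sum>i\<in>A. p i) = (\<Sum>i\<in>A. eval v (p i))"
  by (induction A rule: infinite_finite_induct) simp_all

lemma sum_single_lookup: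
  "(\<Sum>t\<in>Poly_Mapping.keys p. Poly_Mapping.single t (Poly_Mapping.lookup p t)) = p"
  by (rule poly_mapping_eqI) (simp add: lookup_sum lookup_single when_def in_keys_iff)

lemma eval_mult [simp]: "eval v (p * q) = eval v p * eval v (q :: form)"
proof -
  have "p * q = (\<Sum>s\<in>Poly_Mapping.keys p. \<Sum>t\<in>Poly_Mapping.keys q.
      Poly_Mapping.single (s + t) (Poly_Mapping.lookup p s * Poly_Mapping.lookup q t))"
    unfolding mult_single[symmetric] by (simp only: sum_product[symmetric] sum_single_lookup)
  then show ?thesis
    by (simp add: eval_single monom_eval_add eval_eq[of v p] eval_eq[of v q] sum_product ac_simps)
qed

lemma eval_power2 [simp]: "eval v (p\<^sup>2) = (eval v (p :: form))\<^sup>2"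
  by (simp add: power2_eq_square)

lemma eval_Const [simp]: "eval v (Const c) = c"
  by (simp add: Const_def eval_single)

lemma eval_Var [simp]: "eval v (Var u) = v u"
  by (simp add: Var_def eval_single)

text \<open>The coefficients of \<open>p - q\<close> are a linear relation between monomial
  functions, hence zero. Polynomial identities can thus be checked pointwise.\<close>

lemma form_eqI:
  assumes "\<And>v. eval v p = eval v q"
  shows "p = q"
proof -
  have "Poly_Mapping.lookup (p - q) t = 0" if "t \<in> Poly_Mapping.keys (p - q)" for t
    using monom_eval_linear_independent[OF finite_keys _ that, of "Poly_Mapping.lookup (p - q)"] assms
    by (simp add: eval_eq[symmetric])
  then have "p - q = 0"
    by (intro poly_mapping_eqI) (auto simp: in_keys_iff simp flip: lookup_minus)
  then show ?thesis
    by simp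
qed

section \<open>Degrees, and polynomial functions with bounded partial degrees\<close>

lemma deg_in_superset:
  assumes "finite A" "Poly_Mapping.keys t \<subseteq> A"
  shows "deg_in S t = (\<Sum>u\<in>A \<inter> S. Poly_Mapping.lookup t u)"
  unfolding deg_in_def
  by (rule sum.mono_neutral_left) (use assms in \<open>auto simp: in_keys_iff\<close>)

lemma deg_in_add: "deg_in S (s + t) = deg_in S s + deg_in S t"
proof -
  let ?A = "Poly_Mapping.keys s \<union> Poly_Mapping.keys t"
  have "Poly_Mapping.keys (s + t) \<subseteq> ?A"
    by (rule Poly_Mapping.keys_add)
  then show ?thesis
    by (simp add: deg_in_superset[of ?A] lookup_add sum.distrib)
qed

lemma deg_in_single: "deg_in S (Poly_Mapping.single u n) = (if u \<in> S then n else 0)"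
  by (simp add: deg_in_def)

text \<open>Stated for functions rather than forms, so that substitution is mere composition. The
  degrees in the first two groups are only upper bounds, so \<open>VZ\<close> can take the place of
  a variable of either group.\<close>

definition trigraded ::
    "var set \<Rightarrow> nat \<Rightarrow> nat \<Rightarrow> nat \<Rightarrow> ((var \<Rightarrow> real) \<Rightarrow> real) \<Rightarrow> bool"
  where "trigraded V d a b F \<longleftrightarrow> (\<exists>p. homogeneous d p \<and> vars p \<subseteq> V \<and>
    (\<forall>t\<in>Poly_Mapping.keys p. deg_in (range VX) t \<le> a \<and> deg_in (range VY) t \<le> b) \<and>
    (\<forall>v. eval v p = F v))"

lemma trigraded_zero: "trigraded V d a b (\<lambda>_. 0)"
  unfolding trigraded_def by (rule exI[of _ 0]) (simp add: homogeneous_def vars_def)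

lemma trigraded_Var:
  assumes "u \<in> V" "u \<in> range VX \<Longrightarrow> 1 \<le> a" "u \<in> range VY \<Longrightarrow> 1 \<le> b"
  shows "trigraded V 1 a b (\<lambda>v. v u)"
  unfolding trigraded_def
  by (rule exI[of _ "Var u"]) (use assms in \<open>simp add: homogeneous_def vars_def Var_def deg_in_single eval_single\<close>)

lemma trigraded_add:
  assumes "trigraded V d a b F" "trigraded V d a b G"
  shows "trigraded V d a b (\<lambda>v. F v + G v)"
proof -
  obtain p q where pq:
    "homogeneous d p" "vars p \<subseteq> V" "\<And>v. eval v p = F v"
    "\<forall>t\<in>Poly_Mapping.keys p. deg_in (range VX) t \<le> a \<and> deg_in (range VY) t \<le> b"
    "homogeneous d q" "vars q \<subseteq> V" "\<And>v. eval v q = G v"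
    "\<forall>t\<in>Poly_Mapping.keys q. deg_in (range VX) t \<le> a \<and> deg_in (range VY) t \<le> b"
    using assms unfolding trigraded_def by blast
  have keys: "t \<in> Poly_Mapping.keys p \<or> t \<in> Poly_Mapping.keys q"
    if "t \<in> Poly_Mapping.keys (p + q)" for t
    using Poly_Mapping.keys_add[of p q] that by blast
  have "homogeneous d (p + q)" "vars (p + q) \<subseteq> V"
    using keys pq(1,2,5,6) unfolding homogeneous_def vars_def by blast+
  moreover have "\<forall>t\<in>Poly_Mapping.keys (p + q). deg_in (range VX) t \<le> a \<and> deg_in (range VY) t \<le> b"
    using keys pq(4,8) by blast
  ultimately show ?thesis
    unfolding trigraded_def using pq(3,7) by (intro exI[of _ "p + q"]) simp
qed

lemma trigraded_mult:
  assumes "trigraded V d a b F" "trigraded V d' a' b' G"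
  shows "trigraded V (d + d') (a + a') (b + b') (\<lambda>v. F v * G v)"
proof -
  obtain p q where pq:
    "homogeneous d p" "vars p \<subseteq> V" "\<And>v. eval v p = F v"
    "\<forall>t\<in>Poly_Mapping.keys p. deg_in (range VX) t \<le> a \<and> deg_in (range VY) t \<le> b"
    "homogeneous d' q" "vars q \<subseteq> V" "\<And>v. eval v q = G v"
    "\<forall>t\<in>Poly_Mapping.keys q. deg_in (range VX) t \<le> a' \<and> deg_in (range VY) t \<le> b'"
    using assms unfolding trigraded_def by blast
  have "\<exists>s r. t = s + r \<and> s \<in> Poly_Mapping.keys p \<and> r \<in> Poly_Mapping.keys q"
    if "t \<in> Poly_Mapping.keys (p * q)" for t
    using keys_mult[of p q] that by blast
  moreover have "Poly_Mapping.keys (s + r) \<subseteq> V"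
    if "s \<in> Poly_Mapping.keys p" "r \<in> Poly_Mapping.keys q" for s r
    using Poly_Mapping.keys_add[of s r] that pq(2,6) unfolding vars_def by blast
  ultimately have
    "deg_in UNIV t = d + d' \<and> Poly_Mapping.keys t \<subseteq> V \<and>
     deg_in (range VX) t \<le> a + a' \<and> deg_in (range VY) t \<le> b + b'"
    if "t \<in> Poly_Mapping.keys (p * q)" for t
    using pq(1,4,5,8) that unfolding homogeneous_def by (metis add_mono deg_in_add)
  then show ?thesis
    unfolding trigraded_def homogeneous_def vars_def
    by (intro exI[of _ "p * q"]) (auto simp: pq)
qed

lemma trigraded_scale:
  assumes "trigraded V d a b F"
  shows "trigraded V d a b (\<lambda>v. c * F v)"
proof -
  have "trigraded V 0 0 0 (\<lambda>_. c)"
    unfolding trigraded_def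
    by (rule exI[of _ "Const c"]) (auto simp: homogeneous_def vars_def Const_def deg_in_def eval_single)
  from trigraded_mult[OF this assms] show ?thesis
    by simp
qed

lemma trigraded_diff:
  "trigraded V d a b F \<Longrightarrow> trigraded V d a b G \<Longrightarrow> trigraded V d a b (\<lambda>v. F v - G v)"
  using trigraded_add[of V d a b F "\<lambda>v. - 1 * G v"] trigraded_scale[of V d a b G "-1"] by simp

lemma trigraded_sum:
  "(\<And>i. i \<in> A \<Longrightarrow> trigraded V d a b (F i)) \<Longrightarrow> trigraded V d a b (\<lambda>v. \<Sum>i\<in>A. F i v)"
  by (induction A rule: infinite_finite_induct) (auto intro: trigraded_zero trigraded_add)

lemma sum_of_squaresI:
  assumes "\<And>i. i < r \<Longrightarrow> trigraded V 2 a b (Q i)" "\<And>v. eval v p = (\<Sum>i<r. (Q i v)\<^sup>2)"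
  shows "sum_of_squares r p"
proof -
  obtain q where q: "\<And>i. i < r \<Longrightarrow> homogeneous 2 (q i) \<and> (\<forall>v. eval v (q i) = Q i v)"
    using assms(1) unfolding trigraded_def by metis
  have "p = (\<Sum>i<r. (q i)\<^sup>2)"
    by (rule form_eqI) (simp add: assms(2) q)
  then show ?thesis
    unfolding sum_of_squares_def using q by blast
qed

section \<open>Quadratic monomials, continuity, and coefficients of pure powers\<close>

lemma deg_in_UNIV_eq_0: "deg_in UNIV t = 0 \<Longrightarrow> t = 0"
  by (auto simp: deg_in_def in_keys_iff intro: poly_mapping_eqI)

lemma deg_in_UNIV_SucE:
  assumes "deg_in UNIV t = Suc n"
  obtains u s where "t = Poly_Mapping.single u 1 + s" "deg_in UNIV s = n"
proof -
  have "Poly_Mapping.keys t \<noteq> {}"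
    using assms by (metis deg_in_def inf_bot_left nat.distinct(1) sum.empty)
  then obtain u where u: "Poly_Mapping.lookup t u \<noteq> 0"
    by (meson ex_in_conv in_keys_iff)
  define s where "s = t - Poly_Mapping.single u 1"
  have t: "t = Poly_Mapping.single u 1 + s"
    unfolding s_def using u
    by (intro poly_mapping_eqI) (auto simp: lookup_add lookup_minus lookup_single when_def)
  with assms have "deg_in UNIV s = n"
    by (simp add: deg_in_add deg_in_single)
  with t show thesis ..
qed

text \<open>A monomial of degree 2 is a product of two variables, possibly equal; choosing such a
  pair for each monomial prepares the polarization.\<close>

lemma homogeneous_2_eval:
  assumes "homogeneous 2 q"
  obtains a b where
    "\<And>v. eval v q = (\<Sum>t\<in>Poly_Mapping.keys q. Poly_Mapping.lookup q t * v (a t) * v (b t))"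
proof -
  have "\<exists>u w. t = Poly_Mapping.single u 1 + Poly_Mapping.single w 1"
    if "t \<in> Poly_Mapping.keys q" for t
  proof -
    have "deg_in UNIV t = Suc (Suc 0)"
      using assms that by (simp add: homogeneous_def)
    then obtain u s where "t = Poly_Mapping.single u 1 + s" "deg_in UNIV s = Suc 0"
      by (rule deg_in_UNIV_SucE)
    moreover then obtain w r where "s = Poly_Mapping.single w 1 + r" "deg_in UNIV r = 0"
      by (meson deg_in_UNIV_SucE)
    ultimately show ?thesis
      using deg_in_UNIV_eq_0[of r] by auto
  qed
  then obtain a b where
    "\<And>t. t \<in> Poly_Mapping.keys q \<Longrightarrow> t = Poly_Mapping.single (a t) 1 + Poly_Mapping.single (b t) 1"
    by metis
  then have "monom_eval v t = v (a t) * v (b t)" if "t \<in> Poly_Mapping.keys q" for v t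
    using that by (metis monom_eval_add monom_eval_single power_one_right)
  then show thesis
    by (intro that[of a b]) (simp add: eval_eq mult.assoc)
qed

lemma continuous_on_eval:
  assumes "\<And>u. continuous_on S (\<lambda>x. v x u)"
  shows "continuous_on S (\<lambda>x. eval (v x) p)"
  unfolding eval_def by (intro continuous_intros assms)

text \<open>Any other monomial of degree \<open>d\<close> contains a variable different from
  \<open>u\<close> and vanishes at the basis vector of \<open>u\<close>. This turns the condition on
  the coefficient of \<open>z^4\<close> into a zero of the form.\<close>

lemma lookup_single_homogeneous:
  assumes "homogeneous d p"
  shows "Poly_Mapping.lookup p (Poly_Mapping.single u d) = eval (\<lambda>w. if w = u then 1 else 0) p"
proof -
  let ?v = "\<lambda>w. if w = u then 1 else 0 :: real" and ?s = "Poly_Mapping.single u d"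
  have "monom_eval ?v t = 0" if t: "t \<in> Poly_Mapping.keys p" "t \<noteq> ?s" for t
  proof -
    have "\<not> Poly_Mapping.keys t \<subseteq> {u}"
    proof
      assume k: "Poly_Mapping.keys t \<subseteq> {u}"
      have "deg_in UNIV t = Poly_Mapping.lookup t u"
        by (subst deg_in_superset[OF _ k]) auto
      then have "Poly_Mapping.lookup t u = d"
        using assms t by (simp add: homogeneous_def)
      then have "t = ?s"
        using k by (intro poly_mapping_eqI) (auto simp: lookup_single when_def in_keys_iff)
      with t show False by simp
    qed
    then show ?thesis
      by (auto simp: monom_eval_def in_keys_iff)
  qed
  moreover have "eval ?v p = (\<Sum>t\<in>insert ?s (Poly_Mapping.keys p). Poly_Mapping.lookup p t * monom_eval ?v t)"
    by (rule eval_superset) auto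
  ultimately have "eval ?v p = (\<Sum>t\<in>insert ?s (Poly_Mapping.keys p).
      if t = ?s then Poly_Mapping.lookup p ?s else 0)"
    by (simp only:, intro sum.cong) auto
  also have "\<dots> = Poly_Mapping.lookup p ?s"
    by (subst sum.delta) auto
  finally show ?thesis ..
qed

section \<open>Biquadratic functions with two variables in the second group\<close>

definition linear_on :: "nat set \<Rightarrow> ((nat \<Rightarrow> real) \<Rightarrow> real) \<Rightarrow> bool"
  where "linear_on I \<alpha> \<longleftrightarrow> (\<exists>c. \<forall>x. \<alpha> x = (\<Sum>i\<in>I. c i * x i))"

text \<open>The matrix need not be symmetric, so any double sum qualifies as it stands. Indexing by
  a set lets a variable be dropped without renumbering.\<close>

definition quadratic_on :: "nat set \<Rightarrow> ((nat \<Rightarrow> real) \<Rightarrow> real) \<Rightarrow> bool"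
  where "quadratic_on I A \<longleftrightarrow> (\<exists>B. \<forall>x. A x = (\<Sum>i\<in>I. \<Sum>j\<in>I. B i j * (x i * x j)))"

definition bilinear_on :: "nat set \<Rightarrow> ((nat \<Rightarrow> real) \<Rightarrow> real \<Rightarrow> real \<Rightarrow> real) \<Rightarrow> bool"
  where "bilinear_on I q \<longleftrightarrow>
    (\<exists>\<alpha> \<beta>. linear_on I \<alpha> \<and> linear_on I \<beta> \<and> (\<forall>x y z. q x y z = \<alpha> x * y + \<beta> x * z))"

definition biquadratic_on :: "nat set \<Rightarrow> ((nat \<Rightarrow> real) \<Rightarrow> real \<Rightarrow> real \<Rightarrow> real) \<Rightarrow> bool"
  where "biquadratic_on I g \<longleftrightarrow>
    (\<exists>A B C. quadratic_on I A \<and> quadratic_on I B \<and> quadratic_on I C \<and>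
      (\<forall>x y z. g x y z = A x * y\<^sup>2 + B x * (y * z) + C x * z\<^sup>2))"

lemma biquadratic_onI:
  assumes "quadratic_on I A" "quadratic_on I B" "quadratic_on I C"
  shows "biquadratic_on I (\<lambda>x y z. A x * y\<^sup>2 + B x * (y * z) + C x * z\<^sup>2)"
  unfolding biquadratic_on_def using assms by (intro exI[of _ A] exI[of _ B] exI[of _ C]) simp

text \<open>For a quadratic form this is its symmetric bilinear form; the polarization identity
  avoids choosing a matrix.\<close>

definition polar :: "((nat \<Rightarrow> real) \<Rightarrow> real) \<Rightarrow> (nat \<Rightarrow> real) \<Rightarrow> (nat \<Rightarrow> real) \<Rightarrow> real"
  where "polar A x y = (A (\<lambda>i. x i + y i) - A x - A y) / 2"

lemma linear_on_coord: "finite I \<Longrightarrow> p \<in> I \<Longrightarrow> linear_on I (\<lambda>x. x p)"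
  unfolding linear_on_def
  by (rule exI[of _ "\<lambda>i. if i = p then 1 else 0"])
    (simp add: if_distrib[of "\<lambda>c. c * _"] cong: if_cong)

lemma linear_on_add: "linear_on I \<alpha> \<Longrightarrow> linear_on I \<beta> \<Longrightarrow> linear_on I (\<lambda>x. \<alpha> x + \<beta> x)"
  unfolding linear_on_def
  by (elim exE, rule_tac x = "\<lambda>i. c i + ca i" in exI) (simp add: sum.distrib algebra_simps)

lemma linear_on_scale: "linear_on I \<alpha> \<Longrightarrow> linear_on I (\<lambda>x. k * \<alpha> x)"
  unfolding linear_on_def
  by (elim exE, rule_tac x = "\<lambda>i. k * c i" in exI) (simp add: sum_distrib_left mult.assoc)

lemma linear_on_zero: "linear_on I (\<lambda>_. 0)"
  unfolding linear_on_def by (rule exI[of _ "\<lambda>_. 0"]) simp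

lemma linear_on_mono: "linear_on J \<alpha> \<Longrightarrow> J \<subseteq> I \<Longrightarrow> finite I \<Longrightarrow> linear_on I \<alpha>"
  unfolding linear_on_def
  by (elim exE, rule_tac x = "\<lambda>i. if i \<in> J then c i else 0" in exI)
    (auto intro!: sum.mono_neutral_cong_left)

lemma linear_on_comb:
  "linear_on I \<alpha> \<Longrightarrow> \<alpha> (\<lambda>i. a * x i + b * y i) = a * \<alpha> x + b * \<alpha> y"
  unfolding linear_on_def by (auto simp: sum_distrib_left algebra_simps simp flip: sum.distrib)

text \<open>When \<open>x0 p = 1\<close>, the inner map is the projection along \<open>x0\<close>
  onto the hyperplane where coordinate \<open>p\<close> is 0.\<close>

lemma linear_on_proj:
  assumes "linear_on I \<gamma>" "finite I" "p \<in> I"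
  shows "linear_on I (\<lambda>x. \<gamma> (\<lambda>i. x i - x p * x0 i))"
proof -
  have "\<gamma> (\<lambda>i. x i - x p * x0 i) = \<gamma> x + (- \<gamma> x0) * x p" for x
    using linear_on_comb[OF assms(1), of 1 x "- x p" x0] by simp
  then show ?thesis
    using linear_on_add[OF assms(1) linear_on_scale[OF linear_on_coord[OF assms(2,3)], of "- \<gamma> x0"]]
    by simp
qed

lemma quadratic_on_add: "quadratic_on I A \<Longrightarrow> quadratic_on I A' \<Longrightarrow> quadratic_on I (\<lambda>x. A x + A' x)"
  unfolding quadratic_on_def
  by (elim exE, rule_tac x = "\<lambda>i j. B i j + Ba i j" in exI) (simp add: sum.distrib algebra_simps)

lemma quadratic_on_scale: "quadratic_on I A \<Longrightarrow> quadratic_on I (\<lambda>x. k * A x)"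
  unfolding quadratic_on_def
  by (elim exE, rule_tac x = "\<lambda>i j. k * B i j" in exI) (simp add: sum_distrib_left mult.assoc)

lemma quadratic_on_diff: "quadratic_on I A \<Longrightarrow> quadratic_on I B \<Longrightarrow> quadratic_on I (\<lambda>x. A x - B x)"
  using quadratic_on_add[of I A "\<lambda>x. - 1 * B x"] quadratic_on_scale[of I B "-1"] by simp

lemma quadratic_on_mult: "linear_on I \<alpha> \<Longrightarrow> linear_on I \<beta> \<Longrightarrow> quadratic_on I (\<lambda>x. \<alpha> x * \<beta> x)"
  unfolding quadratic_on_def linear_on_def
  by (elim exE, rule_tac x = "\<lambda>i j. c i * ca j" in exI) (simp add: sum_product ac_simps)

lemma quadratic_on_cong:
  "quadratic_on I A \<Longrightarrow> (\<And>i. i \<in> I \<Longrightarrow> x i = y i) \<Longrightarrow> A x = A y"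
  unfolding quadratic_on_def by (elim exE) (simp cong: sum.cong)

text \<open>On the hyperplane where coordinate \<open>p\<close> is 0, row and column
  \<open>p\<close> of the matrix contribute nothing and can be deleted.\<close>

lemma quadratic_on_restrict:
  assumes "quadratic_on I A" "finite I"
  obtains A' where "quadratic_on (I - {p}) A'" "\<And>x. x p = 0 \<Longrightarrow> A' x = A x"
proof -
  obtain B where B: "\<And>x. A x = (\<Sum>i\<in>I. \<Sum>j\<in>I. B i j * (x i * x j))"
    using assms(1) unfolding quadratic_on_def by blast
  show thesis
  proof
    show "quadratic_on (I - {p}) (\<lambda>x. \<Sum>i\<in>I - {p}. \<Sum>j\<in>I - {p}. B i j * (x i * x j))"
      unfolding quadratic_on_def by blast
  next
    fix x :: "nat \<Rightarrow> real"
    assume x: "x p = 0"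
    have "(\<Sum>i\<in>I - {p}. \<Sum>j\<in>I - {p}. B i j * (x i * x j)) = (\<Sum>i\<in>I - {p}. \<Sum>j\<in>I. B i j * (x i * x j))"
      using assms(2) x by (intro sum.cong refl sum.mono_neutral_left) auto
    also have "\<dots> = A x"
      unfolding B using assms(2) x by (intro sum.mono_neutral_left) auto
    finally show "(\<Sum>i\<in>I - {p}. \<Sum>j\<in>I - {p}. B i j * (x i * x j)) = A x" .
  qed
qed

lemma polar_matrix:
  assumes "\<And>x. A x = (\<Sum>i\<in>I. \<Sum>j\<in>I. B i j * (x i * x j))"
  shows "polar A x y = (\<Sum>i\<in>I. \<Sum>j\<in>I. B i j * (x i * y j + y i * x j)) / 2"
  unfolding polar_def assms sum_subtractf[symmetric]
  by (simp add: algebra_simps)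

lemma linear_on_polar:
  assumes "quadratic_on I A"
  shows "linear_on I (\<lambda>x. polar A x y)"
proof -
  obtain B where B: "\<And>x. A x = (\<Sum>i\<in>I. \<Sum>j\<in>I. B i j * (x i * x j))"
    using assms unfolding quadratic_on_def by blast
  have "polar A x y = (\<Sum>i\<in>I. (\<Sum>j\<in>I. (B i j + B j i) * y j) / 2 * x i)" for x
  proof -
    have "(\<Sum>i\<in>I. \<Sum>j\<in>I. B i j * (y i * x j)) = (\<Sum>i\<in>I. \<Sum>j\<in>I. B j i * (y j * x i))"
      by (rule sum.swap)
    then have "polar A x y = (\<Sum>i\<in>I. \<Sum>j\<in>I. (B i j + B j i) * y j * x i) / 2"
      unfolding polar_matrix[OF B] by (simp add: sum.distrib algebra_simps)
    then show ?thesis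
      by (simp add: sum_divide_distrib sum_distrib_right)
  qed
  then show ?thesis
    unfolding linear_on_def by (intro exI allI)
qed

lemma quadratic_on_line:
  assumes "quadratic_on I A"
  shows "A (\<lambda>i. x i + w * y i) = A x + 2 * w * polar A x y + w\<^sup>2 * A y"
proof -
  obtain B where B: "\<And>x. A x = (\<Sum>i\<in>I. \<Sum>j\<in>I. B i j * (x i * x j))"
    using assms unfolding quadratic_on_def by blast
  show ?thesis
    unfolding polar_matrix[OF B]
    by (simp add: B sum_distrib_left power2_eq_square algebra_simps sum.distrib)
qed

lemma quadratic_on_homogeneous: "quadratic_on I A \<Longrightarrow> A (\<lambda>i. k * x i) = k\<^sup>2 * A x"
  unfolding quadratic_on_def by (elim exE) (simp add: sum_distrib_left power2_eq_square ac_simps)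

text \<open>With a nonzero slope the function would take the value -1 at
  \<open>- (a + 1) / b\<close>.\<close>

lemma affine_nonneg:
  fixes a b :: real
  assumes "\<And>w. 0 \<le> a + w * b"
  shows "b = 0"
proof (rule ccontr)
  assume "b \<noteq> 0"
  then show False
    using assms[of "- (a + 1) / b"] by simp
qed

text \<open>Along any line in direction \<open>y\<close> the function \<open>C\<close> is affine and
  nonnegative, hence constant.\<close>

lemma polar_eq_0:
  assumes "quadratic_on I C" "\<And>x. 0 \<le> C x" "C y = 0"
  shows "polar C x y = 0"
proof -
  have "0 \<le> C x + w * (2 * polar C x y)" for w
    using assms(2)[of "\<lambda>i. x i + w * y i"] quadratic_on_line[OF assms(1), of x w y] assms(3)
    by (simp add: algebra_simps)
  then show ?thesis
    using affine_nonneg[of "C x" "2 * polar C x y"] by auto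
qed

section \<open>Substitutions, differences, homogeneity and continuity\<close>

lemma bilinear_on_change:
  assumes "bilinear_on I q"
  shows "bilinear_on I (\<lambda>x y z. q x (k * y + l * z) (k' * y + l' * z))"
proof -
  obtain \<alpha> \<beta> where l: "linear_on I \<alpha>" "linear_on I \<beta>" and q: "\<And>x y z. q x y z = \<alpha> x * y + \<beta> x * z"
    using assms unfolding bilinear_on_def by blast
  show ?thesis
    unfolding bilinear_on_def q
    by (rule exI[of _ "\<lambda>x. k * \<alpha> x + k' * \<beta> x"], rule exI[of _ "\<lambda>x. l * \<alpha> x + l' * \<beta> x"])
      (auto intro!: linear_on_add linear_on_scale l simp: algebra_simps)
qed

lemma biquadratic_on_change:
  assumes "biquadratic_on I g"
  shows "biquadratic_on I (\<lambda>x y z. g x (k * y + l * z) (k' * y + l' * z))"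
proof -
  obtain A B C where l: "quadratic_on I A" "quadratic_on I B" "quadratic_on I C"
    and g: "\<And>x y z. g x y z = A x * y\<^sup>2 + B x * (y * z) + C x * z\<^sup>2"
    using assms unfolding biquadratic_on_def by blast
  show ?thesis
    unfolding biquadratic_on_def g
    by (rule exI[of _ "\<lambda>x. k\<^sup>2 * A x + (k * k') * B x + k'\<^sup>2 * C x"],
        rule exI[of _ "\<lambda>x. (2 * k * l) * A x + (k * l' + k' * l) * B x + (2 * k' * l') * C x"],
        rule exI[of _ "\<lambda>x. l\<^sup>2 * A x + (l * l') * B x + l'\<^sup>2 * C x"])
      (intro conjI quadratic_on_add quadratic_on_scale l, simp add: algebra_simps power2_eq_square)
qed

lemma biquadratic_on_diff_square:
  assumes "biquadratic_on I g" "bilinear_on I q"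
  shows "biquadratic_on I (\<lambda>x y z. g x y z - (q x y z)\<^sup>2)"
proof -
  obtain A B C where l: "quadratic_on I A" "quadratic_on I B" "quadratic_on I C"
    and g: "\<And>x y z. g x y z = A x * y\<^sup>2 + B x * (y * z) + C x * z\<^sup>2"
    using assms unfolding biquadratic_on_def by blast
  obtain \<alpha> \<beta> where l': "linear_on I \<alpha>" "linear_on I \<beta>" and q: "\<And>x y z. q x y z = \<alpha> x * y + \<beta> x * z"
    using assms unfolding bilinear_on_def by blast
  show ?thesis
    unfolding biquadratic_on_def g q
    by (rule exI[of _ "\<lambda>x. A x - \<alpha> x * \<alpha> x"],
        rule exI[of _ "\<lambda>x. B x - 2 * (\<alpha> x * \<beta> x)"],
        rule exI[of _ "\<lambda>x. C x - \<beta> x * \<beta> x"])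
      (intro conjI quadratic_on_diff quadratic_on_scale quadratic_on_mult l l',
        simp add: algebra_simps power2_eq_square)
qed

lemma bilinear_on_homogeneous:
  assumes "bilinear_on I q"
  shows "q (\<lambda>i. k * x i) (l * y) (l * z) = k * l * q x y z"
proof -
  obtain \<alpha> \<beta> where l: "linear_on I \<alpha>" "linear_on I \<beta>" and q: "\<And>x y z. q x y z = \<alpha> x * y + \<beta> x * z"
    using assms unfolding bilinear_on_def by blast
  show ?thesis
    using linear_on_comb[OF l(1), of k x 0] linear_on_comb[OF l(2), of k x 0]
    by (simp add: q algebra_simps)
qed

lemma biquadratic_on_homogeneous:
  "biquadratic_on I g \<Longrightarrow> g (\<lambda>i. k * x i) (l * y) (l * z) = (k * l)\<^sup>2 * g x y z"
  unfolding biquadratic_on_def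
  by (auto simp: quadratic_on_homogeneous algebra_simps power2_eq_square)

lemma biquadratic_on_cong:
  "biquadratic_on I g \<Longrightarrow> (\<And>i. i \<in> I \<Longrightarrow> x i = x' i) \<Longrightarrow> g x y z = g x' y z"
  unfolding biquadratic_on_def using quadratic_on_cong by (metis (no_types, lifting))

lemma continuous_on_quadratic_on:
  assumes "quadratic_on I A"
  shows "continuous_on UNIV A"
proof -
  obtain B where "A = (\<lambda>x. \<Sum>i\<in>I. \<Sum>j\<in>I. B i j * (x i * x j))"
    using assms unfolding quadratic_on_def by blast
  then show ?thesis
    by (auto intro!: continuous_intros)
qed

text \<open>Maximizing \<open>x\<^sub>p\<^sup>2 y\<^sup>2 / g\<close> over the product of the unit spheres gives the largest multiple
  of \<open>x\<^sub>p\<^sup>2 y\<^sup>2\<close> below \<open>g\<close>.\<close>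

lemma subtract_square_until_zero:
  assumes I: "finite I" "I \<noteq> {}" and g: "biquadratic_on I g" and psd: "\<And>x y z. 0 \<le> g x y z"
  obtains q p x s t where "bilinear_on I q" "\<And>x y z. (q x y z)\<^sup>2 \<le> g x y z"
    "p \<in> I" "x p = 1" "s\<^sup>2 + t\<^sup>2 = 1" "g x s t = (q x s t)\<^sup>2"
proof -
  note result = that
  \<comment> \<open>By bihomogeneity any nontrivial point of contact can be rescaled to the required
    normalization.\<close>
  have norm: thesis if q: "bilinear_on I q" "\<And>x y z. (q x y z)\<^sup>2 \<le> g x y z"
    and p: "p \<in> I" "x p \<noteq> 0" and st: "(s, t) \<noteq> (0, 0)" and eq: "g x s t = (q x s t)\<^sup>2" for q p x s t
  proof -
    define n where "n = sqrt (s\<^sup>2 + t\<^sup>2)"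
    have "0 < s\<^sup>2 + t\<^sup>2"
      using st by (auto simp: sum_power2_gt_zero_iff)
    then have n: "n \<noteq> 0" "n\<^sup>2 = s\<^sup>2 + t\<^sup>2"
      by (auto simp: n_def)
    show thesis
    proof (rule result[OF q p(1), of "\<lambda>i. 1 / x p * x i" "1 / n * s" "1 / n * t"])
      show "1 / x p * x p = 1"
        using p by simp
      show "(1 / n * s)\<^sup>2 + (1 / n * t)\<^sup>2 = 1"
        using n(1) unfolding power_mult_distrib power_divide n(2)[symmetric]
        by (simp flip: n(2) add_divide_distrib)
      show "g (\<lambda>i. 1 / x p * x i) (1 / n * s) (1 / n * t)
          = (q (\<lambda>i. 1 / x p * x i) (1 / n * s) (1 / n * t))\<^sup>2"
        unfolding biquadratic_on_homogeneous[OF g] bilinear_on_homogeneous[OF q(1)] eq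
        by (simp add: power_mult_distrib power_divide)
    qed
  qed
  show thesis
  proof (cases "\<exists>p x s t. p \<in> I \<and> x p \<noteq> 0 \<and> (s, t) \<noteq> (0, 0) \<and> g x s t = 0")
    case True
    \<comment> \<open>A nontrivial zero of \<open>g\<close> is already present, so the zero form is
      subtracted.\<close>
    have "bilinear_on I (\<lambda>_ _ _. 0)"
      unfolding bilinear_on_def by (intro exI[of _ "\<lambda>_. 0"]) (simp add: linear_on_zero)
    then show thesis
      using norm[of "\<lambda>_ _ _. 0"] psd True by auto
  next
    case False
    then have pos: "0 < g x s t" if "p \<in> I" "x p \<noteq> 0" "(s, t) \<noteq> (0, 0)" for p x s t
      using that psd[of x s t] by (metis less_eq_real_def)
    obtain p where p: "p \<in> I"
      using I by blast
    \<comment> \<open>The sphere is cut out of a product of compact intervals. Coordinates outside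
      \<open>I\<close> are pinned to 0, so that compactness holds in the space of all functions on
      \<open>nat\<close>.\<close>
    define X where "X = (\<Pi>\<^sub>E i\<in>UNIV. if i \<in> I then {-1..1} else {0::real}) \<inter> {x. (\<Sum>i\<in>I. (x i)\<^sup>2) = 1}"
    define Y where "Y = {yz :: real \<times> real. (fst yz)\<^sup>2 + (snd yz)\<^sup>2 = 1}"
    have "compact (\<Pi>\<^sub>E i\<in>UNIV. if i \<in> I then {-1..1} else {0::real})"
      unfolding compactin_euclidean_iff[symmetric] euclidean_product_topology[symmetric] compactin_PiE
      by simp
    moreover have "closed {x :: nat \<Rightarrow> real. (\<Sum>i\<in>I. (x i)\<^sup>2) = 1}"
      by (intro closed_Collect_eq continuous_intros) auto
    ultimately have "compact X"
      unfolding X_def by (rule compact_Int_closed)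
    have le1: "y \<in> {-1..1}" if "y\<^sup>2 + z\<^sup>2 = 1" for y z :: real
    proof -
      have "y\<^sup>2 \<le> 1"
        using zero_le_power2[of z] that by linarith
      then show ?thesis
        by (simp add: abs_square_le_1 abs_le_iff)
    qed
    have Y_eq: "Y = ({-1..1} \<times> {-1..1}) \<inter> {yz. (fst yz)\<^sup>2 + (snd yz)\<^sup>2 = 1}"
    proof -
      have "y \<in> {-1..1} \<and> z \<in> {-1..1}" if "y\<^sup>2 + z\<^sup>2 = 1" for y z :: real
        using le1[of y z] le1[of z y] that by (simp add: add.commute)
      then show ?thesis
        unfolding Y_def by auto
    qed
    moreover have "closed {yz :: real \<times> real. (fst yz)\<^sup>2 + (snd yz)\<^sup>2 = 1}"
      by (intro closed_Collect_eq continuous_intros)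
    ultimately have "compact Y"
      unfolding Y_eq by (intro compact_Int_closed compact_Times compact_Icc)
    let ?K = "X \<times> Y"
    let ?e = "\<lambda>i. if i = p then 1 else 0 :: real"
    let ?\<phi> = "\<lambda>(x, y, z). (x p * y)\<^sup>2 / g x y z"
    have posK: "0 < g x y z" if "(x, y, z) \<in> ?K" for x y z
    proof -
      have "\<exists>i\<in>I. x i \<noteq> 0"
      proof (rule ccontr)
        assume "\<not> ?thesis"
        then have "(\<Sum>i\<in>I. (x i)\<^sup>2) = 0"
          by simp
        then show False
          using that by (simp add: X_def)
      qed
      moreover have "(y, z) \<noteq> (0, 0)"
        using that by (auto simp: Y_def)
      ultimately show ?thesis
        using pos by blast
    qed
    obtain A B C where ABC: "quadratic_on I A" "quadratic_on I B" "quadratic_on I C"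
      and g_eq: "\<And>x y z. g x y z = A x * y\<^sup>2 + B x * (y * z) + C x * z\<^sup>2"
      using g unfolding biquadratic_on_def by blast
    have "continuous_on ?K (\<lambda>v. A' (fst v))" if "quadratic_on I A'" for A'
      by (rule continuous_on_compose2[OF continuous_on_quadratic_on[OF that] continuous_on_fst])
        (simp_all add: continuous_on_id)
    note cont = this[OF ABC(1)] this[OF ABC(2)] this[OF ABC(3)]
    have coord: "continuous_on ?K (\<lambda>v. fst v p)"
      by (rule continuous_on_product_then_coordinatewise) (intro continuous_intros)
    have "continuous_on ?K (\<lambda>v. (fst v p * fst (snd v))\<^sup>2 / g (fst v) (fst (snd v)) (snd (snd v)))"
      unfolding g_eq
    proof (intro continuous_intros cont coord)
      show "\<forall>v\<in>?K. A (fst v) * (fst (snd v))\<^sup>2 + B (fst v) * (fst (snd v) * snd (snd v))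
          + C (fst v) * (snd (snd v))\<^sup>2 \<noteq> 0"
        using posK unfolding g_eq by fastforce
    qed
    then have "continuous_on ?K ?\<phi>"
      by (simp add: case_prod_unfold)
    moreover have "compact ?K"
      using \<open>compact X\<close> \<open>compact Y\<close> by (rule compact_Times)
    moreover have e: "(?e, 1, 0) \<in> ?K"
    proof -
      have "(\<Sum>i\<in>I. (?e i)\<^sup>2) = (\<Sum>i\<in>I. if i = p then 1 else 0)"
        by (rule sum.cong) auto
      then have "(\<Sum>i\<in>I. (?e i)\<^sup>2) = 1"
        using p I by simp
      moreover have "?e i \<in> (if i \<in> I then {-1..1} else {0})" for i
        using p by simp
      ultimately show ?thesis
        by (simp add: X_def Y_def PiE_iff)
    qed
    ultimately obtain k where k: "k \<in> ?K" "\<And>v. v \<in> ?K \<Longrightarrow> ?\<phi> v \<le> ?\<phi> k"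
      using continuous_attains_sup[of ?K ?\<phi>] by blast
    obtain x0 s t where k_eq: "k = (x0, s, t)"
      by (cases k)
    define M where "M = (x0 p * s)\<^sup>2 / g x0 s t"
    \<comment> \<open>The basis point \<open>(?e, 1, 0)\<close> shows that the maximum is positive,
      so dividing by \<open>M\<close> is legitimate.\<close>
    have "0 < (?e p * 1)\<^sup>2 / g ?e 1 0"
      using posK[OF e] by simp
    also have "\<dots> \<le> M"
      using k(2)[OF e] by (simp add: M_def k_eq)
    finally have M: "0 < M" .
    define q where "q = (\<lambda>(x :: nat \<Rightarrow> real) y (z :: real). 1 / sqrt M * x p * y)"
    have q: "bilinear_on I q"
      unfolding bilinear_on_def q_def
      by (rule exI[of _ "\<lambda>x. 1 / sqrt M * x p"], rule exI[of _ "\<lambda>_. 0"])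
        (intro conjI linear_on_zero linear_on_scale linear_on_coord p I, simp)
    have q2: "(q x y z)\<^sup>2 = (x p * y)\<^sup>2 / M" for x y z
      using M by (simp add: q_def power_mult_distrib power_divide)
    have le: "(q x y z)\<^sup>2 \<le> g x y z" for x y z
    \<comment> \<open>If either group of variables is zero, so is \<open>q\<close>. Otherwise both
      groups are scaled to the unit spheres; clearing coordinates outside \<open>I\<close> does not
      change \<open>g\<close>.\<close>
    proof (cases "(\<Sum>i\<in>I. (x i)\<^sup>2) = 0 \<or> y\<^sup>2 + z\<^sup>2 = 0")
      case True
      then have "x p = 0 \<or> y = 0"
        using I p by (auto simp: sum_nonneg_eq_0_iff sum_power2_eq_zero_iff)
      then show ?thesis
        using psd by (auto simp: q_def)
    next
      case False
      define N where "N = sqrt (\<Sum>i\<in>I. (x i)\<^sup>2)"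
      define n where "n = sqrt (y\<^sup>2 + z\<^sup>2)"
      have N: "0 < N" "N\<^sup>2 = (\<Sum>i\<in>I. (x i)\<^sup>2)" and n: "0 < n" "n\<^sup>2 = y\<^sup>2 + z\<^sup>2"
        using False sum_nonneg[of I "\<lambda>i. (x i)\<^sup>2"] by (auto simp: N_def n_def less_le)
      define x' where "x' = (\<lambda>i. if i \<in> I then 1 / N * x i else 0)"
      have "(\<Sum>i\<in>I. (x' i)\<^sup>2) = (\<Sum>i\<in>I. (x i)\<^sup>2) / N\<^sup>2"
        unfolding sum_divide_distrib by (rule sum.cong) (auto simp: x'_def power_divide)
      then have one: "(\<Sum>i\<in>I. (x' i)\<^sup>2) = 1"
        using N False by simp
      have "x' i \<in> (if i \<in> I then {-1..1} else {0})" for i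
      proof (cases "i \<in> I")
        case True
        then have "(x' i)\<^sup>2 \<le> 1"
          unfolding one[symmetric] using I by (intro member_le_sum) auto
        then show ?thesis
          using True by (simp add: abs_square_le_1 abs_le_iff)
      qed (simp add: x'_def)
      moreover have "(1 / n * y)\<^sup>2 + (1 / n * z)\<^sup>2 = 1"
        using n False by (simp add: power_divide flip: add_divide_distrib)
      ultimately have mem: "(x', 1 / n * y, 1 / n * z) \<in> ?K"
        using one by (auto simp: X_def Y_def)
      have gx: "g x' (1 / n * y) (1 / n * z) = (1 / N * (1 / n))\<^sup>2 * g x y z"
        using biquadratic_on_homogeneous[OF g, of "1 / N" x "1 / n"]
          biquadratic_on_cong[OF g, of x' "\<lambda>i. 1 / N * x i"] by (simp add: x'_def)
      have eq: "(x' p * (1 / n * y))\<^sup>2 = (1 / N * (1 / n))\<^sup>2 * (x p * y)\<^sup>2"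
        using p by (simp add: x'_def power_mult_distrib power_divide)
      have "(x' p * (1 / n * y))\<^sup>2 \<le> M * g x' (1 / n * y) (1 / n * z)"
        using k(2)[OF mem] posK[OF mem] by (simp add: M_def k_eq divide_le_eq)
      then have "(1 / N * (1 / n))\<^sup>2 * (x p * y)\<^sup>2 \<le> (1 / N * (1 / n))\<^sup>2 * (M * g x y z)"
        unfolding gx eq by (simp only: mult.left_commute)
      then have "(x p * y)\<^sup>2 \<le> M * g x y z"
        using N(1) n(1) by (subst (asm) mult_le_cancel_left_pos) auto
      then show ?thesis
        unfolding q2 using M by (simp add: divide_le_eq mult.commute)
    qed
    have "g x0 s t = (q x0 s t)\<^sup>2"
      unfolding q2 using M posK[of x0 s t] k(1) by (auto simp: M_def k_eq)
    moreover have "x0 p \<noteq> 0" "s \<noteq> 0"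
      using M by (auto simp: M_def)
    ultimately show thesis
      using norm[OF q le p] by blast
  qed
qed

text \<open>At a zero \<open>(x\<^sub>0, (0, 1))\<close> the terms in \<open>w\<^sup>2 y z\<close>, \<open>w\<^sup>2 z\<^sup>2\<close> and \<open>w x z\<^sup>2\<close> vanish, where \<open>w\<close> is the
  coordinate along \<open>x\<^sub>0\<close>; completing the square in \<open>w y\<close> eliminates \<open>w\<close>.\<close>

lemma split_square_at_zero:
  assumes I: "finite I" "p \<in> I" and g: "biquadratic_on I g" and psd: "\<And>x y z. 0 \<le> g x y z"
    and x0: "x0 p = 1" "g x0 0 1 = 0"
  obtains q g' where "bilinear_on I q" "biquadratic_on (I - {p}) g'" "\<And>x y z. 0 \<le> g' x y z"
    "\<And>x y z. g x y z = (q x y z)\<^sup>2 + g' (\<lambda>i. x i - x p * x0 i) y z"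
proof -
  obtain A B C where ABC: "quadratic_on I A" "quadratic_on I B" "quadratic_on I C"
    and g_eq: "\<And>x y z. g x y z = A x * y\<^sup>2 + B x * (y * z) + C x * z\<^sup>2"
    using g unfolding biquadratic_on_def by blast
  have C0: "C x0 = 0"
    using x0 by (simp add: g_eq)
  have Cpsd: "0 \<le> C x" for x
    using psd[of x 0 1] by (simp add: g_eq)
  \<comment> \<open>As \<open>C x0 = 0\<close>, the value of \<open>g\<close> at \<open>x0\<close>,
    1 and \<open>w\<close> is affine in \<open>w\<close>.\<close>
  have "0 \<le> A x0 + w * B x0" for w
    using psd[of x0 1 w] C0 by (simp add: g_eq mult.commute)
  then have B0: "B x0 = 0"
    by (rule affine_nonneg)
  have polC: "polar C x x0 = 0" for x
    using polar_eq_0[OF ABC(3) Cpsd C0] .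
  define c where "c = A x0"
  have c: "0 \<le> c"
    using psd[of x0 1 0] by (simp add: g_eq c_def)
  define \<alpha> \<beta> where "\<alpha> = (\<lambda>x. polar A x x0)" and "\<beta> = (\<lambda>x. polar B x x0)"
  have lin: "linear_on I \<alpha>" "linear_on I \<beta>"
    unfolding \<alpha>_def \<beta>_def by (auto intro: linear_on_polar ABC)
  have expand: "g (\<lambda>i. x i + w * x0 i) y z
      = c * (w * y)\<^sup>2 + 2 * (w * y) * (\<alpha> x * y + \<beta> x * z) + g x y z" for x w y z
    unfolding g_eq quadratic_on_line[OF ABC(1)] quadratic_on_line[OF ABC(2)]
      quadratic_on_line[OF ABC(3)]
    by (simp add: B0 C0 polC c_def \<alpha>_def \<beta>_def algebra_simps power2_eq_square)
  \<comment> \<open>What remains of \<open>g\<close> after completing the square. For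
    \<open>c = 0\<close> the convention \<open>1 / 0 = 0\<close> means that nothing is subtracted,
    which is right because the cross term vanishes too.\<close>
  define h where "h = (\<lambda>x y z. g x y z - (sqrt (1 / c) * (\<alpha> x * y + \<beta> x * z))\<^sup>2)"
  have lin_c0: "\<alpha> x = 0 \<and> \<beta> x = 0" if "c = 0" for x
  proof -
    have "\<alpha> x + \<beta> x * z = 0" for z
    proof -
      have "0 \<le> g x 1 z + w * (2 * (\<alpha> x + \<beta> x * z))" for w
        using psd[of "\<lambda>i. x i + w * x0 i" 1 z] unfolding expand that by (simp add: algebra_simps)
      from affine_nonneg[OF this] show ?thesis
        by simp
    qed
    from this[of 0] this[of 1] show ?thesis
      by simp
  qed
  define q where "q = (\<lambda>x y z. sqrt c * (x p * y)
    + sqrt (1 / c) * (\<alpha> (\<lambda>i. x i - x p * x0 i) * y + \<beta> (\<lambda>i. x i - x p * x0 i) * z))"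
  have q: "bilinear_on I q"
    unfolding bilinear_on_def q_def
    by (rule exI[of _ "\<lambda>x. sqrt c * x p + sqrt (1 / c) * \<alpha> (\<lambda>i. x i - x p * x0 i)"],
        rule exI[of _ "\<lambda>x. sqrt (1 / c) * \<beta> (\<lambda>i. x i - x p * x0 i)"])
      (intro conjI linear_on_add linear_on_scale linear_on_proj lin linear_on_coord I,
        simp add: algebra_simps)
  have split: "g x y z = (q x y z)\<^sup>2 + h (\<lambda>i. x i - x p * x0 i) y z" for x y z
  proof -
    let ?x = "\<lambda>i. x i - x p * x0 i"
    let ?L = "\<alpha> ?x * y + \<beta> ?x * z"
    have 1: "g x y z = c * (x p * y)\<^sup>2 + 2 * (x p * y) * ?L + g ?x y z"
      using expand[of ?x "x p" y z] by simp
    show ?thesis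
    proof (cases "c = 0")
      case True
      then show ?thesis
        unfolding 1 by (simp add: q_def h_def lin_c0)
    next
      case False
      then have "sqrt c * sqrt (1 / c) = 1"
        using c by (simp flip: real_sqrt_mult)
      then have "(sqrt c * a + sqrt (1 / c) * b)\<^sup>2 = c * a\<^sup>2 + 2 * a * b + (sqrt (1 / c) * b)\<^sup>2" for a b
        using c by (simp add: power2_sum power_mult_distrib)
      then show ?thesis
        unfolding 1 q_def h_def by simp
    qed
  qed
  have h: "biquadratic_on I h"
    unfolding h_def
  proof (rule biquadratic_on_diff_square[OF g])
    show "bilinear_on I (\<lambda>x y z. sqrt (1 / c) * (\<alpha> x * y + \<beta> x * z))"
      unfolding bilinear_on_def
      by (rule exI[of _ "\<lambda>x. sqrt (1 / c) * \<alpha> x"], rule exI[of _ "\<lambda>x. sqrt (1 / c) * \<beta> x"])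
        (intro conjI linear_on_scale lin, simp add: algebra_simps)
  qed
  have h_nonneg1: "0 \<le> h x y z" if y: "y \<noteq> 0" for x y z
  proof (cases "c = 0")
    case True
    then show ?thesis
      using psd by (simp add: h_def)
  next
    case False
    then have "0 < c"
      using c by simp
    define L where "L = \<alpha> x * y + \<beta> x * z"
    \<comment> \<open>The shift along \<open>x0\<close> is chosen as the minimizer of the quadratic
      in \<open>w\<close>, where the value of \<open>g\<close> is that of \<open>h\<close>.\<close>
    have "0 \<le> c * ((- L / (c * y)) * y)\<^sup>2 + 2 * ((- L / (c * y)) * y) * L + g x y z"
      using psd[of "\<lambda>i. x i + (- L / (c * y)) * x0 i" y z] unfolding expand L_def .
    also have "\<dots> = g x y z - L\<^sup>2 / c"
      using \<open>0 < c\<close> y by (simp add: field_simps power2_eq_square)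
    also have "\<dots> = h x y z"
      using \<open>0 < c\<close> by (simp add: h_def L_def power_mult_distrib)
    finally show ?thesis .
  qed
  obtain A' B' C' where ABC': "quadratic_on I A'" "quadratic_on I B'" "quadratic_on I C'"
    and h_eq: "\<And>x y z. h x y z = A' x * y\<^sup>2 + B' x * (y * z) + C' x * z\<^sup>2"
    using h unfolding biquadratic_on_def by blast
  \<comment> \<open>The minimizer does not exist for \<open>y = 0\<close>; this case follows as a
    limit from \<open>y \<noteq> 0\<close>.\<close>
  have h_nonneg: "0 \<le> h x y z" for x y z
  proof (cases "y = 0")
    case True
    have "continuous_on UNIV (\<lambda>y. h x y z)"
      unfolding h_eq by (intro continuous_intros)
    then have "((\<lambda>y. h x y z) \<longlongrightarrow> h x 0 z) (at 0)"
      by (simp add: continuous_on_def)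
    then have "0 \<le> h x 0 z"
      by (rule tendsto_lowerbound) (auto simp: eventually_at_filter h_nonneg1)
    then show ?thesis
      using True by simp
  qed (rule h_nonneg1)
  obtain A'' B'' C'' where ABC'': "quadratic_on (I - {p}) A''" "\<And>x. x p = 0 \<Longrightarrow> A'' x = A' x"
    "quadratic_on (I - {p}) B''" "\<And>x. x p = 0 \<Longrightarrow> B'' x = B' x"
    "quadratic_on (I - {p}) C''" "\<And>x. x p = 0 \<Longrightarrow> C'' x = C' x"
    using quadratic_on_restrict[OF ABC'(1) I(1)] quadratic_on_restrict[OF ABC'(2) I(1)]
      quadratic_on_restrict[OF ABC'(3) I(1)] by metis
  define g' where "g' = (\<lambda>x y z. A'' x * y\<^sup>2 + B'' x * (y * z) + C'' x * z\<^sup>2)"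
  have g': "biquadratic_on (I - {p}) g'"
    unfolding biquadratic_on_def g'_def using ABC'' by blast
  have g'_eq: "g' x y z = h x y z" if "x p = 0" for x y z
    using that by (simp add: g'_def h_eq ABC'')
  \<comment> \<open>\<open>g'\<close> ignores coordinate \<open>p\<close>, so nonnegativity on the
    hyperplane extends to all \<open>x\<close>.\<close>
  have "0 \<le> g' x y z" for x y z
    using biquadratic_on_cong[OF g', of x "x(p := 0)" y z] g'_eq[of "x(p := 0)" y z] h_nonneg
    by simp
  moreover have "g x y z = (q x y z)\<^sup>2 + g' (\<lambda>i. x i - x p * x0 i) y z" for x y z
    using split g'_eq[of "\<lambda>i. x i - x p * x0 i" y z] x0 by simp
  ultimately show thesis
    using that[OF q g'] by blast
qed

text \<open>This is Calderon's theorem. Each variable costs two squares: one subtracted to produce a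
  zero, one split off to eliminate the variable at that zero.\<close>

lemma psd_biquadratic_on_sos:
  assumes "finite I" "biquadratic_on I g" "\<And>x y z. 0 \<le> g x y z"
  shows "\<exists>r q. (\<forall>i<r. bilinear_on I (q i)) \<and> (\<forall>x y z. g x y z = (\<Sum>i<r::nat. (q i x y z)\<^sup>2))"
  using assms
proof (induction "card I" arbitrary: I g)
  case 0
  then have "I = {}"
    by simp
  then have "g x y z = 0" for x y z
    using \<open>biquadratic_on I g\<close> by (auto simp: biquadratic_on_def quadratic_on_def)
  then show ?case
    by (intro exI[of _ 0]) simp
next
  case (Suc n)
  have "I \<noteq> {}"
    using Suc.hyps(2) by auto
  then obtain q0 p x0 s t where q0: "bilinear_on I q0" "\<And>x y z. (q0 x y z)\<^sup>2 \<le> g x y z"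
    and p: "p \<in> I" "x0 p = 1" and st: "s\<^sup>2 + t\<^sup>2 = 1" and eq: "g x0 s t = (q0 x0 s t)\<^sup>2"
    using subtract_square_until_zero[OF Suc.prems(1) _ Suc.prems(2,3)] by metis
  define f where "f = (\<lambda>x y z. g x y z - (q0 x y z)\<^sup>2)"
  \<comment> \<open>An orthogonal reflection that maps \<open>(0, 1)\<close> to
    \<open>(s, t)\<close>. It is its own inverse, so the same substitution undoes it in
    \<open>Q\<close> below.\<close>
  define f1 where "f1 = (\<lambda>x y z. f x ((- t) * y + s * z) (s * y + t * z))"
  have f: "biquadratic_on I f"
    unfolding f_def by (rule biquadratic_on_diff_square[OF Suc.prems(2) q0(1)])
  then have f1: "biquadratic_on I f1"
    unfolding f1_def by (rule biquadratic_on_change)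
  have f_psd: "0 \<le> f x y z" for x y z
    using q0(2) by (simp add: f_def)
  then have f1_psd: "0 \<le> f1 x y z" for x y z
    by (simp add: f1_def)
  have "f1 x0 0 1 = 0"
    using eq by (simp add: f1_def f_def)
  then obtain q1 g' where q1: "bilinear_on I q1" "biquadratic_on (I - {p}) g'" "\<And>x y z. 0 \<le> g' x y z"
    and f1_eq: "\<And>x y z. f1 x y z = (q1 x y z)\<^sup>2 + g' (\<lambda>i. x i - x p * x0 i) y z"
    using split_square_at_zero[of I p f1 x0, OF Suc.prems(1) p(1) f1 f1_psd p(2)] by blast
  have "n = card (I - {p})"
    using Suc.hyps(2) Suc.prems(1) p by simp
  then obtain r q where q: "\<And>i. i < r \<Longrightarrow> bilinear_on (I - {p}) (q i)"
    and g'_eq: "\<And>x y z. g' x y z = (\<Sum>i<r::nat. (q i x y z)\<^sup>2)"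
    using Suc.hyps(1)[OF _ _ q1(2,3)] Suc.prems(1) by (metis finite_Diff)
  have lift: "bilinear_on I (\<lambda>x. q i (\<lambda>i. x i - x p * x0 i))" if "i < r" for i
  proof -
    obtain \<alpha> \<beta> where l: "linear_on (I - {p}) \<alpha>" "linear_on (I - {p}) \<beta>"
      and qi: "\<And>x y z. q i x y z = \<alpha> x * y + \<beta> x * z"
      using q[OF \<open>i < r\<close>] unfolding bilinear_on_def by blast
    have "linear_on I (\<lambda>x. \<gamma> (\<lambda>i. x i - x p * x0 i))" if "linear_on (I - {p}) \<gamma>" for \<gamma>
      using linear_on_proj[OF linear_on_mono[OF that]] Suc.prems(1) p(1) by auto
    then show ?thesis
      unfolding bilinear_on_def using l qi by blast
  qed
  define Q where "Q i = (\<lambda>x y z.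
    case i of 0 \<Rightarrow> q0 x y z
    | Suc 0 \<Rightarrow> q1 x ((- t) * y + s * z) (s * y + t * z)
    | Suc (Suc j) \<Rightarrow> q j (\<lambda>i. x i - x p * x0 i) ((- t) * y + s * z) (s * y + t * z))" for i
  have "bilinear_on I (Q i)" if "i < Suc (Suc r)" for i
    using that q0(1) bilinear_on_change[OF q1(1), of "- t" s s t]
      bilinear_on_change[OF lift, of _ "- t" s s t]
    by (cases i rule: nat.exhaust; cases "i - 1") (auto simp: Q_def)
  moreover have "g x y z = (\<Sum>i<Suc (Suc r). (Q i x y z)\<^sup>2)" for x y z
  proof -
    have "f x y z = f1 x ((- t) * y + s * z) (s * y + t * z)"
    proof -
      have "(- t) * ((- t) * y + s * z) + s * (s * y + t * z) = (s\<^sup>2 + t\<^sup>2) * y"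
        "s * ((- t) * y + s * z) + t * (s * y + t * z) = (s\<^sup>2 + t\<^sup>2) * z"
        by (simp_all add: algebra_simps power2_eq_square)
      then show ?thesis
        unfolding f1_def st by simp
    qed
    then have "g x y z = (q0 x y z)\<^sup>2 + f1 x ((- t) * y + s * z) (s * y + t * z)"
      by (simp add: f_def)
    then show ?thesis
      unfolding f1_eq g'_eq sum.lessThan_Suc_shift by (simp add: Q_def)
  qed
  ultimately show ?case
    by blast
qed

section \<open>Lifting sums of squares\<close>

text \<open>The last clause is degree bookkeeping: with one argument fixed, substituting linear
  functions of \<open>v\<close> into the other gives a linear function of \<open>v\<close> with the
  same degree bounds.\<close>

definition polarization :: "form \<Rightarrow> ((var \<Rightarrow> real) \<Rightarrow> (var \<Rightarrow> real) \<Rightarrow> real) \<Rightarrow> bool"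
  where "polarization q b \<longleftrightarrow>
    (\<forall>v. eval v q = b v v) \<and> (\<forall>v w. b v w = b w v) \<and>
    (\<forall>c u d v w. b (\<lambda>x. c * u x + d * v x) w = c * b u w + d * b v w) \<and>
    (\<forall>V k l L w. (\<forall>u. trigraded V 1 k l (\<lambda>v. L v u)) \<longrightarrow> trigraded V 1 k l (\<lambda>v. b (L v) w))"

lemma homogeneous_2_polarization:
  assumes "homogeneous 2 q"
  shows "\<exists>b. polarization q b"
proof -
  obtain \<iota> \<kappa> where q:
    "\<And>v. eval v q = (\<Sum>t\<in>Poly_Mapping.keys q. Poly_Mapping.lookup q t * v (\<iota> t) * v (\<kappa> t))"
    using homogeneous_2_eval[OF assms] by blast
  define b where "b v w = (\<Sum>t\<in>Poly_Mapping.keys q.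
    (Poly_Mapping.lookup q t / 2 * w (\<kappa> t)) * v (\<iota> t)
    + (Poly_Mapping.lookup q t / 2 * w (\<iota> t)) * v (\<kappa> t))" for v w :: "var \<Rightarrow> real"
  have "polarization q b"
    unfolding polarization_def
  proof (intro conjI allI impI)
    show "eval v q = b v v" for v
      unfolding q b_def by (rule sum.cong) simp_all
    show "b v w = b w v" for v w
      unfolding b_def by (rule sum.cong) (simp_all add: ac_simps)
    show "b (\<lambda>x. c * u x + d * v x) w = c * b u w + d * b v w" for c u d v w
      unfolding b_def sum_distrib_left sum.distrib[symmetric]
      by (rule sum.cong) (simp_all add: algebra_simps add_divide_distrib)
    show "trigraded V 1 k l (\<lambda>v. b (L v) w)" if "\<forall>u. trigraded V 1 k l (\<lambda>v. L v u)" for V k l L w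
      unfolding b_def by (intro trigraded_sum trigraded_add trigraded_scale that[rule_format])
  qed
  then show ?thesis
    by blast
qed

lemma trigraded_linear_on:
  assumes "linear_on I \<alpha>" "\<And>i. i \<in> I \<Longrightarrow> trigraded V d a b (\<lambda>v. X v i)"
  shows "trigraded V d a b (\<lambda>v. \<alpha> (X v))"
proof -
  obtain c where "\<And>x. \<alpha> x = (\<Sum>i\<in>I. c i * x i)"
    using assms(1) unfolding linear_on_def by blast
  then show ?thesis
    by (simp add: trigraded_sum trigraded_scale assms(2))
qed

lemma trigraded_bilinear_on:
  assumes "bilinear_on I q" "\<And>i. i \<in> I \<Longrightarrow> trigraded V 1 1 0 (\<lambda>v. X v i)"
    "trigraded V 1 0 1 Y" "trigraded V 1 0 1 Z"
  shows "trigraded V 2 1 1 (\<lambda>v. q (X v) (Y v) (Z v))"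
proof -
  obtain \<alpha> \<beta> where l: "linear_on I \<alpha>" "linear_on I \<beta>" and q: "\<And>x y z. q x y z = \<alpha> x * y + \<beta> x * z"
    using assms(1) unfolding bilinear_on_def by blast
  show ?thesis
    using trigraded_add[OF trigraded_mult[OF trigraded_linear_on[OF l(1) assms(2)] assms(3)]
        trigraded_mult[OF trigraded_linear_on[OF l(2) assms(2)] assms(4)]]
    by (simp add: q numeral_2_eq_2)
qed

lemma eval_biquadratic_2:
  obtains g where "biquadratic_on {1..m} g"
    "\<And>v. eval v (biquadratic m 2 a) = g (\<lambda>i. v (VX i)) (v (VY 1)) (v (VY 2))"
proof
  let ?S = "\<lambda>c x. \<Sum>i\<in>{1..m}. \<Sum>j\<in>{1..m}. c i j * (x i * x j) :: real"
  let ?g = "\<lambda>x y z. ?S (\<lambda>i j. a i j 1 1) x * y\<^sup>2 + ?S (\<lambda>i j. a i j 1 2 + a i j 2 1) x * (y * z)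
    + ?S (\<lambda>i j. a i j 2 2) x * z\<^sup>2"
  have "quadratic_on {1..m} (?S c)" for c
    unfolding quadratic_on_def by (rule exI[of _ c]) simp
  then show "biquadratic_on {1..m} ?g"
    by (intro biquadratic_onI)
  have two: "{1..2} = {1, 2 :: nat}"
    by auto
  show "eval v (biquadratic m 2 a) = ?g (\<lambda>i. v (VX i)) (v (VY 1)) (v (VY 2))" for v
    unfolding biquadratic_def two sum_distrib_right sum.distrib[symmetric] eval_sum
    by (intro sum.cong refl) (simp add: algebra_simps power2_eq_square)
qed

text \<open>On the line through \<open>v\<close> in direction \<open>d\<close>, both
  \<open>w\<close> and \<open>z\<close> are nonzero for all but at most two parameters, and
  continuity gives the value at 0. This removes the divisions made in the lift.\<close>

lemma eval_eq_0_of_generic: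
  assumes generic: "\<And>v. w v \<noteq> 0 \<Longrightarrow> z v \<noteq> 0 \<Longrightarrow> eval v P = 0"
    and w: "\<And>v e. w (\<lambda>u. v u + e * d u) = w v + e"
    and z: "\<And>v e. z (\<lambda>u. v u + e * d u) = z v + e"
  shows "eval v P = 0"
proof -
  define \<phi> where "\<phi> e = eval (\<lambda>u. v u + e * d u) P" for e
  have "continuous_on UNIV \<phi>"
    unfolding \<phi>_def by (intro continuous_on_eval continuous_intros)
  then have "(\<phi> \<longlongrightarrow> \<phi> 0) (at 0)"
    by (simp add: continuous_on_def)
  moreover have "\<forall>\<^sub>F e in at 0. \<phi> e = 0"
    using eventually_neq_at_within[of "- w v" 0 UNIV] eventually_neq_at_within[of "- z v" 0 UNIV]
  proof eventually_elim
    case (elim e)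
    then have "w v + e \<noteq> 0" "z v + e \<noteq> 0"
      by linarith+
    then show ?case
      unfolding \<phi>_def by (intro generic) (simp_all only: w z not_False_eq_True)
  qed
  then have "(\<phi> \<longlongrightarrow> 0) (at 0)"
    by (rule tendsto_eventually)
  ultimately have "\<phi> 0 = 0"
    by (rule LIM_unique)
  then show ?thesis
    by (simp add: \<phi>_def)
qed

section \<open>Construction of the tripartite form and lift of its representations\<close>

theorem theorem2p3:
  fixes m :: nat and a :: "nat \<Rightarrow> nat \<Rightarrow> nat \<Rightarrow> nat \<Rightarrow> real" and f :: form
  assumes "m \<ge> 2"
    and "f = biquadratic m 2 a"
    and "biquadratic_pos_def m 2 f"
  shows "\<exists>h :: form. tripartite_quartic (m - 1) 1 h \<and> degenerated h \<and> sos h \<and>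
           sosrank f \<le> sosrank h + 1"
proof -
  let ?I = "{1..m}"
  obtain g where g: "biquadratic_on ?I g"
    and f: "\<And>v. eval v f = g (\<lambda>i. v (VX i)) (v (VY 1)) (v (VY 2))"
    unfolding assms(2) using eval_biquadratic_2 by blast
  have g_psd: "0 \<le> g x y z" for x y z
  proof (cases "(\<forall>i\<in>?I. x i = 0) \<or> y = 0 \<and> z = 0")
    case True
    then show ?thesis
      using biquadratic_on_cong[OF g, of x "\<lambda>i. 0 * x i"] biquadratic_on_homogeneous[OF g, of 0 x 1 y z]
        biquadratic_on_homogeneous[OF g, of 1 x 0 y z] by auto
  next
    case False
    define v where "v u = (case u of VX i \<Rightarrow> x i | VY k \<Rightarrow> if k = 1 then y else z | VZ \<Rightarrow> 0)" for u
    have "\<exists>k\<in>{1..2}. v (VY k) \<noteq> 0"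
      using False by (intro bexI[of _ "if y = 0 then 2 else 1"]) (auto simp: v_def)
    moreover have "\<exists>i\<in>?I. v (VX i) \<noteq> 0"
      using False by (simp add: v_def)
    ultimately have "0 < eval v f"
      using assms(3) unfolding biquadratic_pos_def_def by blast
    then show ?thesis
      by (simp add: f v_def)
  qed
  have "?I \<noteq> {}"
    using assms(1) by simp
  then obtain q p x0 s t where q: "bilinear_on ?I q" and q_le: "\<And>x y z. (q x y z)\<^sup>2 \<le> g x y z"
    and p: "p \<in> ?I" "x0 p = 1" and st: "s\<^sup>2 + t\<^sup>2 = 1" and touch: "g x0 s t = (q x0 s t)\<^sup>2"
    using subtract_square_until_zero[OF finite_atLeastAtMost _ g g_psd] by metis
  define f' where "f' x y z = g x y z - (q x y z)\<^sup>2" for x y z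
  have f': "biquadratic_on ?I f'"
    unfolding f'_def using biquadratic_on_diff_square[OF g q] .
  have f'_psd: "0 \<le> f' x y z" for x y z
    using q_le by (simp add: f'_def)
  have f'_zero: "f' x0 s t = 0" "f' x 0 0 = 0" "f' (\<lambda>_. 0) y z = 0" for x y z
    using touch biquadratic_on_homogeneous[OF f', of 1 x 0 0 0]
      biquadratic_on_homogeneous[OF f', of 0 x 1 y z] by (simp_all add: f'_def)
  obtain r0 q' where q': "\<And>i. i < r0 \<Longrightarrow> bilinear_on ?I (q' i)"
    and f'_sos: "\<And>x y z. f' x y z = (\<Sum>i<r0::nat. (q' i x y z)\<^sup>2)"
    using psd_biquadratic_on_sos[OF finite_atLeastAtMost f' f'_psd] by metis
  \<comment> \<open>The variables other than \<open>p\<close> are renumbered by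
    \<open>1, ..., m - 1\<close>; \<open>\<sigma>\<close> will invert \<open>\<tau>\<close>.\<close>
  have "card (?I - {p}) = card {1..m - 1}"
    using p by simp
  then obtain \<tau> where \<tau>: "bij_betw \<tau> (?I - {p}) {1..m - 1}"
    by (metis finite_same_card_bij finite_atLeastAtMost finite_Diff)
  define \<sigma> where "\<sigma> = the_inv_into (?I - {p}) \<tau>"
  have \<tau>_in: "\<tau> i \<in> {1..m - 1}" and \<sigma>\<tau>: "\<sigma> (\<tau> i) = i" if "i \<in> ?I" "i \<noteq> p" for i
    using that \<tau> unfolding \<sigma>_def by (auto simp: bij_betw_def the_inv_into_f_f)

  let ?V = "VX ` {1..m - 1} \<union> VY ` {1..1} \<union> {VZ}"
  \<comment> \<open>The original variables in the adapted coordinates, with \<open>VZ\<close>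
    serving both as the coordinate along \<open>x0\<close> and as the one along
    \<open>(s, t)\<close>. It is counted in the first group in \<open>X\<close> and in the second
    group in \<open>Y\<close> and \<open>Z\<close>.\<close>
  define X where "X v i = x0 i * v VZ + (if i = p then 0 else v (VX (\<tau> i)))" for v :: "var \<Rightarrow> real" and i
  define Y where "Y v = s * v VZ + (- t) * v (VY 1)" for v :: "var \<Rightarrow> real"
  define Z where "Z v = t * v VZ + s * v (VY 1)" for v :: "var \<Rightarrow> real"
  have "trigraded ?V 1 1 0 (\<lambda>v. X v i)" if "i \<in> ?I" for i
    unfolding X_def
  proof (intro trigraded_add trigraded_scale)
    show "trigraded ?V 1 1 0 (\<lambda>v. v VZ)"
      by (rule trigraded_Var) auto
    show "trigraded ?V 1 1 0 (\<lambda>v. if i = p then 0 else v (VX (\<tau> i)))"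
    proof (cases "i = p")
      case False
      then show ?thesis
        unfolding if_not_P[OF False] using \<tau>_in[OF that False] by (intro trigraded_Var) auto
    qed (simp add: trigraded_zero)
  qed
  moreover have "trigraded ?V 1 0 1 Y" "trigraded ?V 1 0 1 Z"
    unfolding Y_def Z_def by (intro trigraded_add trigraded_scale trigraded_Var; auto)+
  ultimately have q'_form: "trigraded ?V 2 1 1 (\<lambda>v. q' i (X v) (Y v) (Z v))" if "i < r0" for i
    using trigraded_bilinear_on[OF q'[OF that]] by blast
  have "trigraded ?V (2 + 2) (1 + 1) (1 + 1) (\<lambda>v. \<Sum>i<r0. q' i (X v) (Y v) (Z v) * q' i (X v) (Y v) (Z v))"
    by (intro trigraded_sum trigraded_mult q'_form) auto
  then have "trigraded ?V 4 2 2 (\<lambda>v. \<Sum>i<r0. q' i (X v) (Y v) (Z v) * q' i (X v) (Y v) (Z v))"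
    by (simp only: one_add_one numeral_plus_numeral semiring_norm)
  then obtain h where h: "homogeneous 4 h" "vars h \<subseteq> ?V"
    "\<forall>t\<in>Poly_Mapping.keys h. deg_in (range VX) t \<le> 2 \<and> deg_in (range VY) t \<le> 2"
    and eval_h': "\<And>v. eval v h = (\<Sum>i<r0. q' i (X v) (Y v) (Z v) * q' i (X v) (Y v) (Z v))"
    unfolding trigraded_def by blast
  have eval_h: "eval v h = f' (X v) (Y v) (Z v)" for v
    unfolding eval_h' f'_sos power2_eq_square ..
  define ex where "ex u w = (if w = u then 1 else 0 :: real)" for u w :: var
  \<comment> \<open>At the basis vector of \<open>VZ\<close> the substitution gives the zero
    \<open>(x0, (s, t))\<close> of \<open>f'\<close>; at that of \<open>VY 1\<close> it gives
    \<open>X = 0\<close>.\<close>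
  have h_ex: "eval (ex VZ) h = 0" "eval (ex (VY 1)) h = 0"
    unfolding eval_h using f'_zero by (simp_all add: ex_def X_def[abs_def] Y_def Z_def cong: if_cong)
  have "tripartite_quartic (m - 1) 1 h"
    unfolding tripartite_quartic_def using h by blast
  moreover have "degenerated h"
    unfolding degenerated_def psd_def
    using lookup_single_homogeneous[OF h(1), of VZ] h_ex(1) f'_psd by (simp add: eval_h ex_def[abs_def])
  moreover have "sos h"
    unfolding sos_def
    by (intro exI[of _ r0] sum_of_squaresI[OF q'_form]) (simp_all add: eval_h f'_sos)
  \<comment> \<open>The lift starts from an arbitrary representation of \<open>h\<close>, so it
    applies to a shortest one.\<close>
  moreover have "sum_of_squares (Suc r) f" if r: "sum_of_squares r h" for r
  proof -
    obtain k where k: "\<And>i. i < r \<Longrightarrow> homogeneous 2 (k i)" and h_eq: "h = (\<Sum>i<r. (k i)\<^sup>2)"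
      using r unfolding sum_of_squares_def by blast
    have k_0: "eval v (k i) = 0" if "eval v h = 0" "i < r" for v i
      using that unfolding h_eq by (simp add: sum_nonneg_eq_0_iff)
    obtain b where b_pol: "\<And>i. i < r \<Longrightarrow> polarization (k i) (b i)"
      using homogeneous_2_polarization[OF k] by metis
    have b: "eval v (k i) = b i v v" "b i v w = b i w v"
        "b i (\<lambda>x. c * u x + d * v x) w = c * b i u w + d * b i v w"
      if "i < r" for i c u d v w
      using b_pol[OF that] unfolding polarization_def by blast+
    have b_form: "trigraded UNIV 1 1 0 (\<lambda>v. b i (L v) w)"
      if "i < r" "\<And>u. trigraded UNIV 1 1 0 (\<lambda>v. L v u)" for i L w
      using b_pol[OF that(1)] that(2) unfolding polarization_def by blast
    have b': "b i w (\<lambda>x. c * u x + d * v x) = c * b i w u + d * b i w v" if "i < r" for i w c u d v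
      unfolding b(2)[OF that, of w] by (rule b(3)[OF that])

    \<comment> \<open>The adapted coordinates of \<open>v\<close>: \<open>xs\<close> holds the
      renumbered components after removing the part along \<open>x0\<close>, whose coefficient is
      \<open>v (VX p)\<close>. Next, \<open>y\<close> and \<open>z\<close> invert the substitution
      in the second group.\<close>
    define xs where "xs v u = (case u of
        VX j \<Rightarrow> if j \<in> {1..m - 1} then v (VX (\<sigma> j)) - x0 (\<sigma> j) * v (VX p) else 0
      | _ \<Rightarrow> 0)" for v :: "var \<Rightarrow> real" and u
    define y where "y v = (- t) * v (VY 1) + s * v (VY 2)" for v :: "var \<Rightarrow> real"
    define z where "z v = s * v (VY 1) + t * v (VY 2)" for v :: "var \<Rightarrow> real"
    have xs_form: "trigraded UNIV 1 1 0 (\<lambda>v. xs v u)" for u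
    proof -
      have VX: "trigraded UNIV 1 1 0 (\<lambda>v. v (VX j))" for j
        by (rule trigraded_Var) auto
      show ?thesis
      proof (cases "\<exists>j\<in>{1..m - 1}. u = VX j")
        case True
        then obtain j where "j \<in> {1..m - 1}" "u = VX j"
          by blast
        then show ?thesis
          unfolding xs_def using trigraded_diff[OF VX trigraded_scale[OF VX]] by simp
      next
        case False
        then have "xs v u = 0" for v
          unfolding xs_def by (cases u) auto
        then show ?thesis
          by (simp add: trigraded_zero)
      qed
    qed
    have yz_form: "trigraded UNIV 1 0 1 y" "trigraded UNIV 1 0 1 z"
      unfolding y_def z_def by (intro trigraded_add trigraded_scale trigraded_Var; auto)+
    \<comment> \<open>\<open>h\<close> vanishes at \<open>xs v\<close> and at both basis vectors,
      hence so does each \<open>k i\<close>. The diagonal terms of its polarization drop out and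
      only cross terms remain.\<close>
    have k_expand: "eval (\<lambda>u. c * xs v u + 1 * (y' * ex (VY 1) u + z' * ex VZ u)) (k i)
        = 2 * c * y' * b i (xs v) (ex (VY 1)) + 2 * c * z' * b i (xs v) (ex VZ)
          + 2 * y' * z' * b i (ex (VY 1)) (ex VZ)" if i: "i < r" for i v c y' z'
    proof -
      have "eval (xs v) h = 0"
        unfolding eval_h using f'_zero(2) by (simp add: xs_def Y_def Z_def)
      then have "b i (xs v) (xs v) = 0" "b i (ex (VY 1)) (ex (VY 1)) = 0" "b i (ex VZ) (ex VZ) = 0"
        using k_0[OF _ i] h_ex by (simp_all add: b(1)[OF i])
      then show ?thesis
        unfolding b(1)[OF i] b(3)[OF i] b'[OF i]
        using b(2)[OF i, of "ex VZ" "ex (VY 1)"] b(2)[OF i, of "ex VZ" "xs v"]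
          b(2)[OF i, of "ex (VY 1)" "xs v"]
        by (simp add: algebra_simps)
    qed
    \<comment> \<open>The expansion of \<open>k i\<close> with \<open>v (VX p)\<close> in place of
      \<open>z\<close> in the last product, which makes every term bilinear in the two
      groups.\<close>
    define Q where "Q i v = 2 * (b i (xs v) (ex (VY 1)) * y v) + 2 * (b i (xs v) (ex VZ) * z v)
      + (2 * b i (ex (VY 1)) (ex VZ)) * (v (VX p) * y v)" for i v
    have Q_form: "trigraded UNIV (1 + 1) (1 + 0) (0 + 1) (Q i)" if "i < r" for i
      unfolding Q_def
      by (intro trigraded_add trigraded_scale trigraded_mult b_form that xs_form yz_form
          trigraded_Var) auto
    have q_form: "trigraded UNIV 2 1 1 (\<lambda>v. q (\<lambda>i. v (VX i)) (v (VY 1)) (v (VY 2)))"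
      by (intro trigraded_bilinear_on[OF q] trigraded_Var) auto
    have generic: "f' (\<lambda>i. v (VX i)) (v (VY 1)) (v (VY 2)) = (\<Sum>i<r. (Q i v)\<^sup>2)"
      if nz: "v (VX p) \<noteq> 0" "z v \<noteq> 0" for v
    proof -
      \<comment> \<open>Scaling the first group by \<open>c\<close> makes its coordinate along
        \<open>x0\<close> equal to \<open>z v\<close>, so the point lies where \<open>h\<close>
        describes \<open>f'\<close>. Then \<open>f'\<close> scales by the square of \<open>c\<close>
        and each \<open>k i\<close> equals \<open>c\<close> times \<open>Q i\<close>.\<close>
      define c where "c = z v / v (VX p)"
      have c: "c \<noteq> 0" "c * v (VX p) = z v"
        using nz by (simp_all add: c_def)
      define v' where "v' u = c * xs v u + 1 * (y v * ex (VY 1) u + z v * ex VZ u)" for u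
      have v': "v' VZ = z v" "v' (VY 1) = y v"
        by (simp_all add: v'_def xs_def ex_def)
      have "X v' i = c * v (VX i)" if "i \<in> ?I" for i
        using \<tau>_in[OF that] \<sigma>\<tau>[OF that] p(2) c(2)
        by (auto simp: X_def v') (auto simp: v'_def xs_def ex_def algebra_simps simp flip: c(2))
      moreover have "Y v' = 1 * v (VY 1)" "Z v' = 1 * v (VY 2)"
        unfolding st[symmetric]
        by (simp_all add: Y_def Z_def v' y_def z_def algebra_simps power2_eq_square
            del: One_nat_def)
      ultimately have "eval v' h = f' (\<lambda>i. c * v (VX i)) (1 * v (VY 1)) (1 * v (VY 2))"
        unfolding eval_h by (simp only:) (rule biquadratic_on_cong[OF f'], simp only:)
      also have "\<dots> = c\<^sup>2 * f' (\<lambda>i. v (VX i)) (v (VY 1)) (v (VY 2))"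
        using biquadratic_on_homogeneous[OF f', of c _ 1] by simp
      finally have "c\<^sup>2 * f' (\<lambda>i. v (VX i)) (v (VY 1)) (v (VY 2)) = (\<Sum>i<r. (eval v' (k i))\<^sup>2)"
        unfolding h_eq by simp
      also have "\<dots> = (\<Sum>i<r. (c * Q i v)\<^sup>2)"
      proof (rule sum.cong[OF refl])
        fix i
        assume "i \<in> {..<r}"
        then have "eval v' (k i) = c * Q i v"
          unfolding v'_def by (subst k_expand) (simp_all add: Q_def algebra_simps flip: c(2))
        then show "(eval v' (k i))\<^sup>2 = (c * Q i v)\<^sup>2"
          by simp
      qed
      also have "\<dots> = c\<^sup>2 * (\<Sum>i<r. (Q i v)\<^sup>2)"
        by (simp add: power_mult_distrib sum_distrib_left)
      finally show ?thesis
        using c(1) by simp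
    qed
    have "\<exists>P. \<forall>v. eval v P = Q i v" if "i < r" for i
      using Q_form[OF that] unfolding trigraded_def by blast
    then obtain QP where QP: "\<And>i v. i < r \<Longrightarrow> eval v (QP i) = Q i v"
      by metis
    obtain qP where qP: "\<And>v. eval v qP = q (\<lambda>i. v (VX i)) (v (VY 1)) (v (VY 2))"
      using q_form unfolding trigraded_def by blast
    \<comment> \<open>A polynomial that vanishes wherever the division defining \<open>c\<close>
      makes sense and \<open>c\<close> is nonzero.\<close>
    define P where "P = f - qP\<^sup>2 - (\<Sum>i<r. (QP i)\<^sup>2)"
    have P: "eval v P = f' (\<lambda>i. v (VX i)) (v (VY 1)) (v (VY 2)) - (\<Sum>i<r. (Q i v)\<^sup>2)" for v
      by (simp add: P_def f qP QP f'_def)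
    \<comment> \<open>Moving along \<open>d\<close> changes both \<open>v (VX p)\<close> and
      \<open>z v\<close> at unit speed, the latter because \<open>(s, t)\<close> is a unit
      vector.\<close>
    define d where "d = (\<lambda>u. if u = VX p then 1 else if u = VY 1 then s else if u = VY 2 then t else 0)"
    have "eval v P = 0" for v
    proof (rule eval_eq_0_of_generic[where w = "\<lambda>v. v (VX p)" and z = z and d = d])
      show "eval v P = 0" if "v (VX p) \<noteq> 0" "z v \<noteq> 0" for v
        using generic[OF that] by (simp add: P)
      show "v (VX p) + e * d (VX p) = v (VX p) + e" for v e
        by (simp add: d_def)
      have "z (\<lambda>u. v u + e * d u) = z v + e * (s\<^sup>2 + t\<^sup>2)" for v e
        by (simp add: z_def d_def algebra_simps power2_eq_square)
      then show "z (\<lambda>u. v u + e * d u) = z v + e" for v e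
        by (simp add: st)
    qed
    then have eval_f: "eval v f = (q (\<lambda>i. v (VX i)) (v (VY 1)) (v (VY 2)))\<^sup>2 + (\<Sum>i<r. (Q i v)\<^sup>2)" for v
      using P[of v] by (simp add: f f'_def)
    \<comment> \<open>Index 0 is the square subtracted at the start; it accounts for the extra 1 in
      the bound.\<close>
    define R where "R i v = (case i of 0 \<Rightarrow> q (\<lambda>i. v (VX i)) (v (VY 1)) (v (VY 2)) | Suc j \<Rightarrow> Q j v)" for i v
    show ?thesis
    proof (rule sum_of_squaresI)
      show "trigraded UNIV 2 1 1 (R i)" if "i < Suc r" for i
        using that q_form Q_form[of "i - 1"] by (cases i) (simp_all add: R_def[abs_def] numeral_2_eq_2)
      show "eval v f = (\<Sum>i<Suc r. (R i v)\<^sup>2)" for v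
        unfolding eval_f sum.lessThan_Suc_shift by (simp add: R_def)
    qed
  qed
  moreover have "sosrank f \<le> sosrank h + 1" if "sos h" "\<And>r. sum_of_squares r h \<Longrightarrow> sum_of_squares (Suc r) f"
  proof -
    have "sum_of_squares (LEAST r. sum_of_squares r h) h"
      using that(1) unfolding sos_def by (rule LeastI_ex)
    then have "sum_of_squares (Suc (LEAST r. sum_of_squares r h)) f"
      by (rule that(2))
    then have "sosrank f \<le> enat (Suc (LEAST r. sum_of_squares r h))"
      unfolding sosrank_def by (intro INF_lower) simp
    then show ?thesis
      by (simp add: sosrank_eq_Least[OF that(1)] one_enat_def)
  qed
  ultimately show ?thesis
    by blast
qed

end
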